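(* Let $r\in[-1,0)$ and let $$h(p\circ x)=\bigl(p_1^{-r}x_1^{-r}+\cdots+p_n^{-r}x_n^{-r}\bigr)^{-\frac1r}.$$ Let $f\in C(\mathbb R^n_+)$ and suppose that for any $A>0$ there exists $C_A>0$ such that $|f(x)|\le C_A e^{A|x|}$ for all $x\in\mathbb R^n_+$. A function $\Pi(p,p_0)$, defined for $p=(p_1,\dots,p_n)>0$, $p_0>0$, can be represented in the form $$\Pi(p,p_0)=\int_{\mathbb R^n_+}\bigl(p_0-h(p\circ x)\bigr)_+\varphi(x)\,dx,\qquad \varphi(x)=(-r)^{n-1}(x_1\cdots x_n)^{-r-1}\int_0^{+\infty}t^{n-1}e^{-t}f(tx_1^{-r},\dots,tx_n^{-r})\,dt,$$ if and only if the following three conditions hold (including existence of the derivatives involved): 1. $\Pi(p,+0)=\tfrac{\partial\Pi}{\partial p_0}(p,+0)=0$ for all $p=(p_1,\dots,p_n)>0$; 2. $\Pi(p_1,\dots,p_n,p_0)=p_0\,\Pi\bigl(\tfrac{p_1}{p_0},\dots,\tfrac{p_n}{p_0},1\bigr)$ for all $(p_1,\dots,p_n,p_0)>0$; 3. $\tfrac{\partial^2\Pi}{\partial p_0^2}\bigl(p_1^{-\frac1r},\dots,p_n^{-\frac1r},1\bigr)=\int_{\mathbb R^n_+}e^{-p\cdot x}f(x)\,dx$ for all $p=(p_1,\dots,p_n)>0$.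
   Context: $\mathbb R^n_+=\{x\in\mathbb R^n: x_i\ge0\}$; $p>0$ means all components are positive; $p\circ x=(p_1x_1,\dots,p_nx_n)$; $a_+=\max\{a,0\}$ for $a\in\mathbb R$. For a function $g$ of $(p,p_0)$, $g(p,+0)=\lim_{p_0\to0^+}g(p,p_0)$. *)

theory Defs
  imports "HOL-Analysis.Analysis"
begin

definition nonneg_orthant :: "(real ^ 'n) set" where
  "nonneg_orthant = {x. \<forall>i. 0 \<le> x $ i}"

definition positive_vec :: "real ^ 'n \<Rightarrow> bool" where
  "positive_vec p \<longleftrightarrow> (\<forall>i. 0 < p $ i)"

text \<open>
  The function is applied to \<open>p * x\<close>, where \<open>*\<close> on vectors is the componentwise product.
  Since \<open>0 powr a = 0\<close> and here \<open>- r > 0\<close>, the value is also the intended one when some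
  components vanish.
\<close>

definition h_fun :: "real \<Rightarrow> real ^ 'n \<Rightarrow> real" where
  "h_fun r z = (\<Sum>i\<in>UNIV. (z $ i) powr (- r)) powr (- 1 / r)"

text \<open>
  On the boundary of the orthant, \<open>x\<^sub>i powr (- r - 1)\<close> is \<open>0\<close> when \<open>x\<^sub>i = 0\<close>; the boundary
  is a null set, so this convention does not affect integrals of \<open>phi r f\<close>.
\<close>

definition phi :: "real \<Rightarrow> (real ^ 'n \<Rightarrow> real) \<Rightarrow> real ^ 'n \<Rightarrow> real" where
  "phi r f x =
     (- r) ^ (CARD('n) - 1) * (\<Prod>i\<in>UNIV. x $ i) powr (- r - 1) *
     (LBINT t:{0..}. t ^ (CARD('n) - 1) * exp (- t) * f (\<chi> i. t * (x $ i) powr (- r)))"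

end

theory Submission
  imports Defs
begin

text \<open>
  Put \<open>s = - r\<close>, \<open>q\<^sub>i = p\<^sub>i powr s\<close> and let \<open>L l\<close> be the integral of \<open>exp (- l * (q \<bullet> z)) * f z\<close>
  over the orthant. Insert the definition of \<open>phi\<close> into the integral representing the profit,
  substitute \<open>z\<^sub>i = t * x\<^sub>i powr s\<close> for fixed \<open>t\<close>, and then \<open>t = (q \<bullet> z) * v powr (- s)\<close> for fixed \<open>z\<close>.
  The integral becomes \<open>\<integral> (p\<^sub>0 - v) * L (v powr (- s)) / v dv\<close> over \<open>0 < v < p\<^sub>0\<close>. So the representation
  says that the profit is the double primitive, vanishing to first order at \<open>0\<close>, of the function
  \<open>L (v powr (- s)) / v\<close>, which is condition 3 transported by the homogeneity in condition 2.
\<close>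

text \<open>Both substitutions are carried out for nonnegative functions in the extended nonnegative
  reals, where Tonelli needs no integrability. The signed case follows by splitting into positive
  and negative parts, which requires finiteness of both halves; this cannot be glossed over, because
  a divergent Lebesgue integral has the value 0 by convention. Finiteness is where the growth
  hypothesis enters. As the rate \<open>A\<close> may be arbitrarily small, \<open>L l\<close>
  converges absolutely for every \<open>l > 0\<close>, and with \<open>n\<close> the dimension it is
  \<open>O(l powr (- n))\<close> for large \<open>l\<close>. Hence
  \<open>L (v powr (- s)) / v\<close> is \<open>O(v powr (s * n - 1))\<close> near
  \<open>v = 0\<close>: possibly unbounded there, but integrable, so that its double primitive from
  \<open>0\<close> exists and vanishes to first order. Condition 3 gives a second derivative only at
  \<open>p\<^sub>0 = 1\<close>. Dividing all prices by \<open>u\<close> moves the point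
  \<open>p\<^sub>0 = u\<close> to \<open>1\<close> and multiplies \<open>q\<close> by
  \<open>u powr (- s)\<close>, which is the argument of \<open>L\<close> in the density.\<close>

section \<open>Power substitutions on the half-line and on the open orthant\<close>

lemma nn_integral_eqI_integral:
  fixes f :: "'a \<Rightarrow> real" and g :: "'b \<Rightarrow> real"
  assumes [measurable]: "f \<in> borel_measurable M" "g \<in> borel_measurable N"
    and nonneg: "\<And>x. 0 \<le> f x" "\<And>x. 0 \<le> g x"
    and iff: "\<And>b. integrable M f \<and> integral\<^sup>L M f = b \<longleftrightarrow> integrable N g \<and> integral\<^sup>L N g = b"
  shows "(\<integral>\<^sup>+x. ennreal (f x) \<partial>M) = (\<integral>\<^sup>+x. ennreal (g x) \<partial>N)"
proof (cases "integrable M f")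
  case True
  with iff have "integrable N g" "integral\<^sup>L N g = integral\<^sup>L M f" by auto
  with True show ?thesis by (simp add: nn_integral_eq_integral nonneg)
next
  case False
  with iff have "\<not> integrable N g" by auto
  \<comment> \<open>A nonnegative measurable function that is not integrable has infinite integral,
    so both sides are \<open>\<infinity>\<close>.\<close>
  with False show ?thesis
    by (simp add: integrable_iff_bounded nonneg not_less top_unique)
qed

lemma has_real_derivative_mult_powr:
  fixes c \<alpha> x :: real
  assumes "0 < x"
  shows "((\<lambda>x. c * x powr \<alpha>) has_real_derivative c * \<alpha> * x powr (\<alpha> - 1)) (at x within S)"
  using assms by (auto intro!: derivative_eq_intros)

text \<open>Both signs of \<open>\<alpha>\<close> occur later: a positive exponent for the
  coordinates of \<open>z\<close>, a negative one for the substitution in \<open>t\<close>. The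
  absolute value of the derivative covers the decreasing case.\<close>

lemma nn_integral_powr_subst:
  fixes F :: "real \<Rightarrow> real"
  assumes [measurable]: "F \<in> borel_measurable borel" and nonneg: "\<And>x. 0 \<le> F x"
    and c: "c > 0" and \<alpha>: "\<alpha> \<noteq> 0"
  shows "(\<integral>\<^sup>+x. ennreal (indicator {0<..} x * F x) \<partial>lborel) =
         (\<integral>\<^sup>+x. ennreal (indicator {0<..} x * (\<bar>c * \<alpha> * x powr (\<alpha> - 1)\<bar> * F (c * x powr \<alpha>))) \<partial>lborel)"
proof (rule nn_integral_eqI_integral)
  let ?g = "\<lambda>x. c * x powr \<alpha>" and ?D = "\<lambda>x. \<bar>c * \<alpha> * x powr (\<alpha> - 1)\<bar>"
  have inj: "inj_on ?g {0<..}"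
  proof (rule inj_onI)
    fix x y :: real assume xy: "x \<in> {0<..}" "y \<in> {0<..}" "?g x = ?g y"
    then have "(x powr \<alpha>) powr (1 / \<alpha>) = (y powr \<alpha>) powr (1 / \<alpha>)" using c by simp
    with xy \<alpha> show "x = y" by (simp add: powr_powr)
  qed
  have img: "?g ` {0<..} = {0<..}"
  proof safe
    fix y :: real assume "0 < y"
    then have "y = ?g ((y / c) powr (1 / \<alpha>))" using c \<alpha> by (simp add: powr_powr)
    then show "y \<in> ?g ` {0<..}" by (rule image_eqI) (use \<open>0 < y\<close> c in auto)
  qed (use c in auto)
  fix b
  have "(\<lambda>x. ?D x * F (?g x)) absolutely_integrable_on {0<..} \<and>
          integral {0<..} (\<lambda>x. ?D x * F (?g x)) = b
     \<longleftrightarrow> F absolutely_integrable_on (?g ` {0<..}) \<and> integral (?g ` {0<..}) F = b"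
    by (rule has_absolute_integral_change_of_variables_1' [OF _ _ inj])
       (auto intro!: has_real_derivative_mult_powr)
  then have "set_integrable lebesgue {0<..} (\<lambda>x. ?D x * F (?g x)) \<and>
          set_lebesgue_integral lebesgue {0<..} (\<lambda>x. ?D x * F (?g x)) = b
     \<longleftrightarrow> set_integrable lebesgue {0<..} F \<and> set_lebesgue_integral lebesgue {0<..} F = b"
    unfolding img using set_lebesgue_integral_eq_integral(2) by (metis (no_types, lifting))
  then show "integrable lborel (\<lambda>x. indicator {0<..} x * F x) \<and>
      integral\<^sup>L lborel (\<lambda>x. indicator {0<..} x * F x) = b \<longleftrightarrow>
    integrable lborel (\<lambda>x. indicator {0<..} x * (?D x * F (?g x))) \<and>
      integral\<^sup>L lborel (\<lambda>x. indicator {0<..} x * (?D x * F (?g x))) = b"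
    unfolding set_integrable_def set_lebesgue_integral_def
    by (simp add: integrable_completion integral_completion)
qed (use c nonneg in auto)

lemma prod_Basis_vec: "(\<Prod>b\<in>(Basis :: (real ^ 'n) set). H b) = (\<Prod>i\<in>UNIV. H (axis i 1))"
  by (rule prod.reindex_bij_betw [symmetric])
     (auto simp: bij_betw_def inj_on_def axis_eq_axis Basis_vec_def)

lemma borel_measurable_vec_lambda [measurable (raw)]:
  fixes f :: "'n::finite \<Rightarrow> 'a \<Rightarrow> real"
  assumes [measurable]: "\<And>i. f i \<in> borel_measurable M"
  shows "(\<lambda>x. \<chi> i. f i x) \<in> borel_measurable M"
proof -
  have "(\<lambda>x. \<chi> i. f i x) = (\<lambda>x. \<Sum>i\<in>UNIV. f i x *\<^sub>R axis i 1)"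
    by (auto simp: vec_eq_iff axis_def if_distrib cong: if_cong)
  then show ?thesis by simp
qed

text \<open>
  The substitution theorem of the library for \<open>real ^ 'n\<close> needs a well-ordered index type. For a map
  acting on each coordinate separately, the product structure of Lebesgue measure suffices.
\<close>

lemma lborel_eq_distr_density_componentwise:
  fixes g d :: "real \<Rightarrow> real"
  assumes [measurable]: "g \<in> borel_measurable borel" "d \<in> borel_measurable borel"
    and nonneg: "\<And>x. 0 \<le> d x"
    and eq: "lborel = distr (density lborel (\<lambda>x. ennreal (d x))) borel g"
  shows "(lborel :: (real ^ 'n) measure) =
    distr (density lborel (\<lambda>x. ennreal (\<Prod>i\<in>UNIV. d (x $ i)))) borel (\<lambda>x. \<chi> i. g (x $ i))"
\<comment> \<open>Lebesgue measure is determined by its values on open boxes. The preimage of a box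
  under a componentwise map is a product of one-dimensional preimages, so the integral of the
  product density factors.\<close>
proof (rule lborel_eqI)
  fix l u :: "real ^ 'n"
  assume le: "\<And>b. b \<in> Basis \<Longrightarrow> l \<bullet> b \<le> u \<bullet> b"
  let ?G = "\<lambda>x :: real ^ 'n. \<chi> i. g (x $ i)"
  have [measurable]: "?G -` box l u \<in> sets borel"
    by (rule measurable_sets_borel [where M = borel]) auto
  let ?f = "\<lambda>b x. d x * indicator {l \<bullet> b<..<u \<bullet> b} (g x)"
  have "emeasure (distr (density lborel (\<lambda>x. ennreal (\<Prod>i\<in>UNIV. d (x $ i)))) borel ?G) (box l u)
     = (\<integral>\<^sup>+x. ennreal (\<Prod>i\<in>UNIV. d (x $ i)) * indicator (?G -` box l u) x \<partial>lborel)"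
    by (simp add: emeasure_distr emeasure_density)
  also have "\<dots> = (\<integral>\<^sup>+x. (\<Prod>b\<in>Basis. ennreal (?f b (x \<bullet> b))) \<partial>(lborel :: (real ^ 'n) measure))"
  proof (rule nn_integral_cong)
    fix x :: "real ^ 'n"
    have "(indicator (?G -` box l u) x :: real) = (\<Prod>i\<in>UNIV. indicator {l $ i<..<u $ i} (g (x $ i)))"
      by (auto simp: indicator_def mem_box_cart intro!: prod_zero)
    then have "(\<Prod>i\<in>UNIV. d (x $ i)) * indicator (?G -` box l u) x
        = (\<Prod>b\<in>(Basis :: (real ^ 'n) set). ?f b (x \<bullet> b))"
      by (simp add: prod_Basis_vec prod.distrib inner_axis)
    moreover have "ennreal (\<Prod>i\<in>UNIV. d (x $ i)) * indicator (?G -` box l u) x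
        = ennreal ((\<Prod>i\<in>UNIV. d (x $ i)) * indicator (?G -` box l u) x)"
      by (simp add: ennreal_mult' ennreal_indicator prod_nonneg nonneg)
    ultimately show "ennreal (\<Prod>i\<in>UNIV. d (x $ i)) * indicator (?G -` box l u) x
        = (\<Prod>b\<in>Basis. ennreal (?f b (x \<bullet> b)))"
      by (simp add: prod_ennreal nonneg)
  qed
  also have "\<dots> = (\<Prod>b\<in>(Basis :: (real ^ 'n) set). \<integral>\<^sup>+x. ennreal (?f b x) \<partial>lborel)"
    by (rule nn_integral_lborel_prod) (auto simp: nonneg)
  also have "\<dots> = (\<Prod>b\<in>(Basis :: (real ^ 'n) set). ennreal ((u - l) \<bullet> b))"
  proof (rule prod.cong)
    fix b :: "real ^ 'n" assume b: "b \<in> Basis"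
    have [measurable]: "g -` {l \<bullet> b<..<u \<bullet> b} \<in> sets borel"
      by (rule measurable_sets_borel [where M = borel]) auto
    have "ennreal ((u - l) \<bullet> b) = emeasure lborel {l \<bullet> b<..<u \<bullet> b}"
      using le[OF b] by (simp add: inner_diff_left)
    also have "\<dots> = (\<integral>\<^sup>+x. ennreal (d x) * indicator (g -` {l \<bullet> b<..<u \<bullet> b}) x \<partial>lborel)"
      by (subst eq) (simp add: emeasure_distr emeasure_density)
    also have "\<dots> = (\<integral>\<^sup>+x. ennreal (?f b x) \<partial>lborel)"
      by (rule nn_integral_cong) (auto simp: indicator_def)
    finally show "(\<integral>\<^sup>+x. ennreal (?f b x) \<partial>lborel) = ennreal ((u - l) \<bullet> b)" by simp
  qed simp
  finally show "emeasure (distr (density lborel (\<lambda>x. ennreal (\<Prod>i\<in>UNIV. d (x $ i)))) borel ?G) (box l u)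
     = ennreal (\<Prod>b\<in>Basis. (u - l) \<bullet> b)"
    using le by (simp add: prod_ennreal inner_diff_left)
qed simp

text \<open>
  The power map is continued by the identity to \<open>x \<le> 0\<close>, so that it carries a measure with density
  to Lebesgue measure on the whole line, as the componentwise lemma requires.
\<close>

lemma lborel_eq_distr_density_powr:
  fixes c \<alpha> :: real
  assumes c: "c > 0" and \<alpha>: "\<alpha> > 0"
  shows "lborel = distr (density lborel (\<lambda>x. ennreal (if 0 < x then c * \<alpha> * x powr (\<alpha> - 1) else 1)))
           borel (\<lambda>x. if 0 < x then c * x powr \<alpha> else x)" (is "_ = distr (density _ (\<lambda>x. ennreal (?d x))) _ ?g")
proof (rule measure_eqI)
  fix A :: "real set" assume "A \<in> sets lborel"
  then have [measurable]: "A \<in> sets borel" by simp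
  have [measurable]: "?g -` A \<in> sets borel"
    by (rule measurable_sets_borel [where M = borel]) auto
  \<comment> \<open>The set is cut at \<open>0\<close>: the power substitution turns
    \<open>?I\<close> into \<open>?K\<close>, while on the part \<open>?J\<close> the map is the
    identity with density 1.\<close>
  let ?I = "\<lambda>x :: real. indicator {0<..} x * indicator A x :: real"
    and ?J = "\<lambda>x :: real. ennreal (indicator {..0} x * indicator A x)"
  let ?K = "\<lambda>x. indicator {0<..} x * (\<bar>c * \<alpha> * x powr (\<alpha> - 1)\<bar> * indicator A (c * x powr \<alpha>))"
  have "emeasure lborel A = (\<integral>\<^sup>+x. ennreal (?I x) + ?J x \<partial>lborel)"
    by (simp flip: nn_integral_indicator) (rule nn_integral_cong, auto simp: indicator_def)
  also have "\<dots> = (\<integral>\<^sup>+x. ennreal (?I x) \<partial>lborel) + (\<integral>\<^sup>+x. ?J x \<partial>lborel)"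
    by (simp add: nn_integral_add)
  also have "(\<integral>\<^sup>+x. ennreal (?I x) \<partial>lborel) = (\<integral>\<^sup>+x. ennreal (?K x) \<partial>lborel)"
    using c \<alpha> by (intro nn_integral_powr_subst) auto
  also have "\<dots> + (\<integral>\<^sup>+x. ?J x \<partial>lborel) = (\<integral>\<^sup>+x. ennreal (?K x) + ?J x \<partial>lborel)"
    by (simp add: nn_integral_add)
  also have "\<dots> = (\<integral>\<^sup>+x. ennreal (?d x) * indicator (?g -` A) x \<partial>lborel)"
    using c \<alpha> by (intro nn_integral_cong) (auto simp: indicator_def)
  finally show "emeasure lborel A = emeasure (distr (density lborel (\<lambda>x. ennreal (?d x))) borel ?g) A"
    by (simp add: emeasure_distr emeasure_density)
qed simp

lemma nn_integral_powr_subst_vec: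
  fixes F :: "real ^ 'n \<Rightarrow> ennreal"
  assumes [measurable]: "F \<in> borel_measurable borel" and c: "c > 0" and \<alpha>: "\<alpha> > 0"
  shows "(\<integral>\<^sup>+x. indicator {x. positive_vec x} x * F x \<partial>lborel) =
    (\<integral>\<^sup>+x. indicator {x. positive_vec x} x *
       (ennreal (\<Prod>i\<in>UNIV. c * \<alpha> * (x $ i) powr (\<alpha> - 1)) * F (\<chi> i. c * (x $ i) powr \<alpha>)) \<partial>lborel)"
proof -
  let ?g = "\<lambda>x. if 0 < x then c * x powr \<alpha> else x"
    and ?d = "\<lambda>x. if 0 < x then c * \<alpha> * x powr (\<alpha> - 1) else 1"
  have [measurable]: "{x :: real ^ 'n. positive_vec x} \<in> sets borel"
    unfolding positive_vec_def by measurable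
  have "(\<integral>\<^sup>+x. indicator {x. positive_vec x} x * F x \<partial>lborel) =
     (\<integral>\<^sup>+x. ennreal (\<Prod>i\<in>UNIV. ?d (x $ i)) * (indicator {x. positive_vec x} (\<chi> i. ?g (x $ i)) * F (\<chi> i. ?g (x $ i))) \<partial>lborel)"
    by (subst lborel_eq_distr_density_componentwise [OF _ _ _ lborel_eq_distr_density_powr [OF c \<alpha>]])
       (use c \<alpha> in \<open>auto simp: nn_integral_distr nn_integral_density\<close>)
  also have "\<dots> = (\<integral>\<^sup>+x. indicator {x. positive_vec x} x *
       (ennreal (\<Prod>i\<in>UNIV. c * \<alpha> * (x $ i) powr (\<alpha> - 1)) * F (\<chi> i. c * (x $ i) powr \<alpha>)) \<partial>lborel)"
  proof (rule nn_integral_cong)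
    fix x :: "real ^ 'n"
    \<comment> \<open>The continued map preserves positivity in both directions, so the indicator of
      the open orthant discards the identity branch.\<close>
    have "0 < ?g y \<longleftrightarrow> 0 < y" for y using c by auto
    then have "positive_vec (\<chi> i. ?g (x $ i)) \<longleftrightarrow> positive_vec x"
      by (simp add: positive_vec_def)
    then show "ennreal (\<Prod>i\<in>UNIV. ?d (x $ i)) * (indicator {x. positive_vec x} (\<chi> i. ?g (x $ i)) * F (\<chi> i. ?g (x $ i)))
       = indicator {x. positive_vec x} x *
       (ennreal (\<Prod>i\<in>UNIV. c * \<alpha> * (x $ i) powr (\<alpha> - 1)) * F (\<chi> i. c * (x $ i) powr \<alpha>))"
      by (auto simp: indicator_def positive_vec_def)
  qed
  finally show ?thesis .
qed

lemma positive_vec_set_borel [measurable]: "{x :: real ^ 'n. positive_vec x} \<in> sets borel"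
  unfolding positive_vec_def by measurable

section \<open>The profit integral for nonnegative functions\<close>

text \<open>Three exchanges of integrals alternate with the two substitutions: \<open>t\<close> is
  moved outside to substitute in \<open>x\<close>, then inside to substitute in \<open>t\<close>
  itself, then the resulting \<open>v\<close> is moved outside. With nonnegative integrands each
  exchange is free.\<close>

lemma nn_integral_profit:
  fixes F :: "real ^ 'n \<Rightarrow> real" and q :: "real ^ 'n" and s c :: real
  assumes [measurable]: "F \<in> borel_measurable borel" and nonneg: "\<And>x. 0 \<le> F x"
    and s: "s > 0" and q: "positive_vec q"
  defines "n \<equiv> CARD('n)"
  shows "(\<integral>\<^sup>+x. indicator {x. positive_vec x} x *
           ennreal (max (c - (\<Sum>i\<in>UNIV. q $ i * (x $ i) powr s) powr (1 / s)) 0 *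
             (s ^ (n - 1) * (\<Prod>i\<in>UNIV. x $ i) powr (s - 1))) *
           (\<integral>\<^sup>+t. ennreal (indicator {0<..} t * (t ^ (n - 1) * exp (- t) * F (\<chi> i. t * (x $ i) powr s))) \<partial>lborel) \<partial>lborel)
       = (\<integral>\<^sup>+v. ennreal (indicator {0<..} v * (max (c - v) 0 / v)) *
           (\<integral>\<^sup>+z. ennreal (indicator {x. positive_vec x} z * F z * exp (- (v powr (- s) * (q \<bullet> z)))) \<partial>lborel) \<partial>lborel)"
proof -
  let ?W = "{x :: real ^ 'n. positive_vec x}"
  have n: "n = Suc (n - 1)" unfolding n_def by simp
  \<comment> \<open>\<open>H\<close> is the integrand in the variables \<open>t\<close> and
    \<open>z\<close>. The Jacobian of \<open>x \<mapsto> z\<close> contributes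
    \<open>(t * s) ^ n\<close>, the original integrand only
    \<open>t ^ (n - 1) * s ^ (n - 1)\<close>; the factor \<open>1 / (s * t)\<close> is the
    quotient.\<close>
  define H where "H = (\<lambda>t (z :: real ^ 'n).
    max (c - ((q \<bullet> z) / t) powr (1 / s)) 0 * (1 / (s * t)) * exp (- t) * F z)"
  have [measurable]: "case_prod H \<in> borel_measurable (borel \<Otimes>\<^sub>M borel)"
    unfolding H_def by measurable
  have H_nonneg: "0 \<le> H t z" if "0 < t" for t z
    using that s nonneg by (simp add: H_def)
  have "(\<integral>\<^sup>+x. indicator ?W x *
           ennreal (max (c - (\<Sum>i\<in>UNIV. q $ i * (x $ i) powr s) powr (1 / s)) 0 *
             (s ^ (n - 1) * (\<Prod>i\<in>UNIV. x $ i) powr (s - 1))) *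
           (\<integral>\<^sup>+t. ennreal (indicator {0<..} t * (t ^ (n - 1) * exp (- t) * F (\<chi> i. t * (x $ i) powr s))) \<partial>lborel) \<partial>lborel)
     = (\<integral>\<^sup>+x. (\<integral>\<^sup>+t. indicator {0<..} t * (indicator ?W x *
          (ennreal (\<Prod>i\<in>UNIV. t * s * (x $ i) powr (s - 1)) * ennreal (H t (\<chi> i. t * (x $ i) powr s)))) \<partial>lborel) \<partial>lborel)"
  proof (rule nn_integral_cong)
    fix x :: "real ^ 'n"
    have key: "indicator ?W x *
           ennreal (max (c - (\<Sum>i\<in>UNIV. q $ i * (x $ i) powr s) powr (1 / s)) 0 *
             (s ^ (n - 1) * (\<Prod>i\<in>UNIV. x $ i) powr (s - 1))) *
           ennreal (indicator {0<..} t * (t ^ (n - 1) * exp (- t) * F (\<chi> i. t * (x $ i) powr s))) =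
         indicator {0<..} t * (indicator ?W x *
          (ennreal (\<Prod>i\<in>UNIV. t * s * (x $ i) powr (s - 1)) * ennreal (H t (\<chi> i. t * (x $ i) powr s))))"
      (is "?L t = ?R t") for t
    proof (cases "positive_vec x \<and> 0 < t")
      case True
      then have x: "\<And>i. 0 < x $ i" and t: "0 < t" by (auto simp: positive_vec_def)
      have 1: "q \<bullet> (\<chi> i. t * (x $ i) powr s) = t * (\<Sum>i\<in>UNIV. q $ i * (x $ i) powr s)"
        by (simp add: inner_vec_def sum_distrib_left mult_ac)
      have 2: "(\<Prod>i\<in>UNIV. t * s * (x $ i) powr (s - 1)) = t ^ n * s ^ n * (\<Prod>i\<in>UNIV. x $ i) powr (s - 1)"
        using x by (simp add: prod.distrib n_def power_mult_distrib prod_powr_distrib less_imp_le)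
      have 3: "t ^ n * s ^ n * (1 / (s * t)) = s ^ (n - 1) * t ^ (n - 1)"
        by (subst (1 2) n) (use s t in \<open>simp add: field_simps\<close>)
      have "max (c - (\<Sum>i\<in>UNIV. q $ i * (x $ i) powr s) powr (1 / s)) 0 *
             (s ^ (n - 1) * (\<Prod>i\<in>UNIV. x $ i) powr (s - 1)) *
           (t ^ (n - 1) * exp (- t) * F (\<chi> i. t * (x $ i) powr s))
          = max (c - (\<Sum>i\<in>UNIV. q $ i * (x $ i) powr s) powr (1 / s)) 0 *
             (s ^ (n - 1) * t ^ (n - 1)) * (\<Prod>i\<in>UNIV. x $ i) powr (s - 1) * exp (- t) * F (\<chi> i. t * (x $ i) powr s)"
        by (simp add: mult_ac)
      also have "\<dots> = (\<Prod>i\<in>UNIV. t * s * (x $ i) powr (s - 1)) * H t (\<chi> i. t * (x $ i) powr s)"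
        unfolding H_def 1 2 3 [symmetric] using t by (simp add: mult_ac)
      finally show ?thesis
        using True s t nonneg H_nonneg[OF t] x
        by (simp add: ennreal_mult[symmetric] prod_nonneg)
    qed (auto simp: indicator_def)
    show "indicator ?W x *
           ennreal (max (c - (\<Sum>i\<in>UNIV. q $ i * (x $ i) powr s) powr (1 / s)) 0 *
             (s ^ (n - 1) * (\<Prod>i\<in>UNIV. x $ i) powr (s - 1))) *
           (\<integral>\<^sup>+t. ennreal (indicator {0<..} t * (t ^ (n - 1) * exp (- t) * F (\<chi> i. t * (x $ i) powr s))) \<partial>lborel)
       = (\<integral>\<^sup>+t. ?R t \<partial>lborel)"
      unfolding key [symmetric] by (subst nn_integral_cmult) (auto simp: mult.assoc)
  qed
  also have "\<dots> = (\<integral>\<^sup>+t. (\<integral>\<^sup>+x. indicator {0<..} t * (indicator ?W x *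
          (ennreal (\<Prod>i\<in>UNIV. t * s * (x $ i) powr (s - 1)) * ennreal (H t (\<chi> i. t * (x $ i) powr s)))) \<partial>lborel) \<partial>lborel)"
    by (rule lborel_pair.Fubini') measurable
  also have "\<dots> = (\<integral>\<^sup>+t. (\<integral>\<^sup>+z. indicator {0<..} t * (indicator ?W z * ennreal (H t z)) \<partial>lborel) \<partial>lborel)"
  proof (rule nn_integral_cong)
    fix t :: real
    show "(\<integral>\<^sup>+x. indicator {0<..} t * (indicator ?W x *
          (ennreal (\<Prod>i\<in>UNIV. t * s * (x $ i) powr (s - 1)) * ennreal (H t (\<chi> i. t * (x $ i) powr s)))) \<partial>lborel)
        = (\<integral>\<^sup>+z. indicator {0<..} t * (indicator ?W z * ennreal (H t z)) \<partial>lborel)"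
    proof (cases "0 < t")
      case True
      have "(\<integral>\<^sup>+z. indicator ?W z * ennreal (H t z) \<partial>lborel) = (\<integral>\<^sup>+x. indicator ?W x *
          (ennreal (\<Prod>i\<in>UNIV. t * s * (x $ i) powr (s - 1)) * ennreal (H t (\<chi> i. t * (x $ i) powr s))) \<partial>lborel)"
        by (rule nn_integral_powr_subst_vec) (use True s in auto)
      then show ?thesis using True by simp
    qed simp
  qed
  also have "\<dots> = (\<integral>\<^sup>+z. (\<integral>\<^sup>+t. indicator {0<..} t * (indicator ?W z * ennreal (H t z)) \<partial>lborel) \<partial>lborel)"
    by (rule lborel_pair.Fubini') measurable
  also have "\<dots> = (\<integral>\<^sup>+z. (\<integral>\<^sup>+v. ennreal (indicator {0<..} v * (max (c - v) 0 / v)) *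
           ennreal (indicator ?W z * F z * exp (- (v powr (- s) * (q \<bullet> z)))) \<partial>lborel) \<partial>lborel)"
  proof (rule nn_integral_cong)
    fix z :: "real ^ 'n"
    show "(\<integral>\<^sup>+t. indicator {0<..} t * (indicator ?W z * ennreal (H t z)) \<partial>lborel)
       = (\<integral>\<^sup>+v. ennreal (indicator {0<..} v * (max (c - v) 0 / v)) *
           ennreal (indicator ?W z * F z * exp (- (v powr (- s) * (q \<bullet> z)))) \<partial>lborel)"
    proof (cases "positive_vec z")
      case True
      define a where "a = q \<bullet> z"
      have a: "a > 0" unfolding a_def inner_vec_def using q True
        by (auto simp: positive_vec_def intro!: sum_pos)
      \<comment> \<open>The one-dimensional substitution wants a function that is nonnegative on the
        whole line, but \<open>1 / (s * t)\<close> is negative for \<open>t < 0\<close>. The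
        truncation by \<open>max\<close> changes nothing for \<open>t > 0\<close>.\<close>
      have "(\<integral>\<^sup>+t. indicator {0<..} t * (indicator ?W z * ennreal (H t z)) \<partial>lborel)
          = (\<integral>\<^sup>+t. ennreal (indicator {0<..} t * max (H t z) 0) \<partial>lborel)"
        by (rule nn_integral_cong) (use True H_nonneg in \<open>auto simp: indicator_def max_def intro: antisym\<close>)
      also have "\<dots> = (\<integral>\<^sup>+v. ennreal (indicator {0<..} v *
           (\<bar>a * (- s) * v powr (- s - 1)\<bar> * max (H (a * v powr (- s)) z) 0)) \<partial>lborel)"
        by (rule nn_integral_powr_subst) (use s a in auto)
      also have "\<dots> = (\<integral>\<^sup>+v. ennreal (indicator {0<..} v * (max (c - v) 0 / v)) *
           ennreal (indicator ?W z * F z * exp (- (v powr (- s) * a))) \<partial>lborel)"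
      proof (rule nn_integral_cong)
        fix v :: real
        show "ennreal (indicator {0<..} v *
           (\<bar>a * (- s) * v powr (- s - 1)\<bar> * max (H (a * v powr (- s)) z) 0))
         = ennreal (indicator {0<..} v * (max (c - v) 0 / v)) *
           ennreal (indicator ?W z * F z * exp (- (v powr (- s) * a)))"
        proof (cases "0 < v")
          case v: True
          have 1: "a / (a * v powr (- s)) = v powr s" using a v by (simp add: powr_minus field_simps)
          have 2: "v powr (- s - 1) = v powr (- s) / v" using v by (simp add: powr_diff)
          have pos: "0 < v powr (- s)" using v by simp
          have H: "H (a * v powr (- s)) z = max (c - v) 0 * (1 / (s * (a * v powr (- s)))) * exp (- (a * v powr (- s))) * F z"
            unfolding H_def a_def[symmetric] 1 using s v by (simp add: powr_powr)
          have "0 \<le> H (a * v powr (- s)) z" using a pos by (intro H_nonneg) simp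
          then have m: "max (H (a * v powr (- s)) z) 0 = H (a * v powr (- s)) z"
            by (rule max_absorb1)
          \<comment> \<open>The Jacobian \<open>a * s * v powr (- s - 1)\<close> against the factor
            \<open>1 / (s * t)\<close> at \<open>t = a * v powr (- s)\<close> leaves exactly
            \<open>1 / v\<close>.\<close>
          have "\<bar>a * (- s) * v powr (- s - 1)\<bar> * max (H (a * v powr (- s)) z) 0
              = max (c - v) 0 / v * (F z * exp (- (v powr (- s) * a)))"
            unfolding 2 m unfolding H using s a v pos by (simp add: abs_mult field_simps)
          then show ?thesis using v True nonneg by (simp add: ennreal_mult[symmetric])
        qed simp
      qed
      finally show ?thesis by (simp add: a_def)
    qed simp
  qed
  also have "\<dots> = (\<integral>\<^sup>+v. (\<integral>\<^sup>+z. ennreal (indicator {0<..} v * (max (c - v) 0 / v)) *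
           ennreal (indicator ?W z * F z * exp (- (v powr (- s) * (q \<bullet> z)))) \<partial>lborel) \<partial>lborel)"
    by (rule lborel_pair.Fubini') measurable
  also have "\<dots> = (\<integral>\<^sup>+v. ennreal (indicator {0<..} v * (max (c - v) 0 / v)) *
           (\<integral>\<^sup>+z. ennreal (indicator ?W z * F z * exp (- (v powr (- s) * (q \<bullet> z)))) \<partial>lborel) \<partial>lborel)"
    by (subst nn_integral_cmult) auto
  finally show ?thesis .
qed

section \<open>Laplace integrals over the orthant: convergence, decay and continuity\<close>

lemma nonneg_orthant_borel [measurable]: "(nonneg_orthant :: (real ^ 'n) set) \<in> sets borel"
  unfolding nonneg_orthant_def by measurable

text \<open>The exceptional points lie on finitely many coordinate hyperplanes. This links the
  closed orthant of the theorem with the open one of the substitutions.\<close>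

lemma AE_nonneg_orthant_iff_positive:
  "AE x in lborel. x \<in> (nonneg_orthant :: (real ^ 'n) set) \<longleftrightarrow> positive_vec x"
proof -
  have "negligible {x :: real ^ 'n. x $ i = 0}" for i
    using negligible_standard_hyperplane[of "axis i 1 :: real ^ 'n" 0]
    by (simp add: inner_axis axis_in_Basis_iff)
  then have "negligible (\<Union>i. {x :: real ^ 'n. x $ i = 0})"
    by (intro negligible_Union) auto
  then have "AE x in lebesgue. x \<notin> (\<Union>i. {x :: real ^ 'n. x $ i = 0})"
    unfolding negligible_iff_null_sets by (rule AE_not_in)
  then have "AE x in lborel. x \<notin> (\<Union>i. {x :: real ^ 'n. x $ i = 0})"
    by (simp add: AE_completion_iff)
  then show ?thesis
    by eventually_elim (auto simp: nonneg_orthant_def positive_vec_def less_le)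
qed

lemma nn_integral_exp_minus:
  fixes a :: real
  assumes "a > 0"
  shows "(\<integral>\<^sup>+x. ennreal (indicator {0..} x * exp (- (a * x))) \<partial>lborel) = ennreal (1 / a)"
  using nn_integral_has_integral_lebesgue[OF _ has_integral_exp_minus_to_infinity[OF assms, of 0]]
  by simp

text \<open>Indicator and exponential both factor over the coordinates. The power of
  \<open>1 / l\<close> in the value is the source of the decay of \<open>laplace\<close>.\<close>

lemma nn_integral_exp_minus_orthant:
  fixes q :: "real ^ 'n"
  assumes q: "positive_vec q" and l: "0 < l"
  shows "(\<integral>\<^sup>+z. ennreal (indicator nonneg_orthant z * exp (- (l * (q \<bullet> z)))) \<partial>lborel)
       = ennreal ((1 / l) ^ CARD('n) / (\<Prod>i\<in>UNIV. q $ i))"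
proof -
  let ?f = "\<lambda>b x. indicator {0..} x * exp (- (l * (q \<bullet> b) * x)) :: real"
  have q': "0 < q \<bullet> b" if "b \<in> Basis" for b
    using q that by (auto simp: Basis_vec_def positive_vec_def inner_axis)
  have "(\<integral>\<^sup>+z. ennreal (indicator nonneg_orthant z * exp (- (l * (q \<bullet> z)))) \<partial>lborel)
     = (\<integral>\<^sup>+z. (\<Prod>b\<in>Basis. ennreal (?f b (z \<bullet> b))) \<partial>(lborel :: (real ^ 'n) measure))"
  proof (rule nn_integral_cong)
    fix z :: "real ^ 'n"
    have "indicator nonneg_orthant z = (\<Prod>i\<in>UNIV. indicator {0..} (z $ i) :: real)"
      by (auto simp: indicator_def nonneg_orthant_def intro!: prod_zero)
    moreover have "exp (- (l * (q \<bullet> z))) = (\<Prod>i\<in>UNIV. exp (- (l * q $ i * z $ i)))"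
      by (simp add: exp_sum[symmetric] inner_vec_def sum_distrib_left sum_negf mult_ac)
    ultimately show "ennreal (indicator nonneg_orthant z * exp (- (l * (q \<bullet> z)))) =
        (\<Prod>b\<in>Basis. ennreal (?f b (z \<bullet> b)))"
      by (simp add: prod_ennreal prod_Basis_vec inner_axis prod.distrib)
  qed
  also have "\<dots> = (\<Prod>b\<in>(Basis :: (real ^ 'n) set). \<integral>\<^sup>+x. ennreal (?f b x) \<partial>lborel)"
    by (rule nn_integral_lborel_prod) auto
  also have "\<dots> = (\<Prod>b\<in>(Basis :: (real ^ 'n) set). ennreal (1 / (l * (q \<bullet> b))))"
    by (intro prod.cong nn_integral_exp_minus) (use q' l in auto)
  also have "\<dots> = ennreal (\<Prod>i\<in>UNIV. 1 / (l * q $ i))"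
    using q l by (subst prod_Basis_vec) (auto simp: prod_ennreal inner_axis positive_vec_def less_imp_le)
  also have "(\<Prod>i\<in>UNIV. 1 / (l * q $ i)) = (1 / l) ^ CARD('n) / (\<Prod>i\<in>UNIV. q $ i)"
    by (simp add: prod_dividef prod.distrib power_divide)
  finally show ?thesis .
qed

definition subexponential :: "(real ^ 'n \<Rightarrow> real) \<Rightarrow> bool" where
  "subexponential F \<longleftrightarrow> (\<forall>A>0. \<exists>C>0. \<forall>x\<in>nonneg_orthant. \<bar>F x\<bar> \<le> C * exp (A * norm x))"

text \<open>This is the Laplace transform of \<open>F\<close> at the point
  \<open>l *\<^sub>R q\<close>. Direction and scale are separate arguments because for fixed prices
  only the scale varies.\<close>

definition laplace :: "(real ^ 'n \<Rightarrow> real) \<Rightarrow> real ^ 'n \<Rightarrow> real \<Rightarrow> real" where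
  "laplace F q l = (LBINT z:nonneg_orthant. exp (- (l * (q \<bullet> z))) * F z)"

text \<open>Half of the exponent absorbs the growth of \<open>F\<close>, the other half is
  integrated explicitly. The constant depends on \<open>l0\<close> but not on \<open>l\<close>,
  which yields both absolute convergence and the decay rate for \<open>l \<ge> l0\<close>.\<close>

lemma laplace_nn_bound:
  fixes F :: "real ^ 'n \<Rightarrow> real"
  assumes [measurable]: "F \<in> borel_measurable borel"
    and sub: "subexponential F" and q: "positive_vec q" and l0: "0 < l0"
  obtains K where "0 \<le> K"
    "\<And>l. l0 \<le> l \<Longrightarrow> (\<integral>\<^sup>+z. ennreal (norm (indicator nonneg_orthant z *\<^sub>R (exp (- (l * (q \<bullet> z))) * F z))) \<partial>lborel)
        \<le> ennreal (K * (1 / l) ^ CARD('n))"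
proof -
  define m where "m = Min (range (($) q))"
  have "m \<in> range (($) q)" unfolding m_def by (rule Min_in) auto
  then have m: "m > 0" "\<And>i. m \<le> q $ i" using q by (auto simp: m_def positive_vec_def)
  have qz: "m * norm z \<le> q \<bullet> z" if "z \<in> nonneg_orthant" for z :: "real ^ 'n"
  proof -
    have "m * norm z \<le> m * (\<Sum>i\<in>UNIV. z $ i)"
      using norm_le_l1_cart[of z] that m(1) by (simp add: nonneg_orthant_def)
    also have "\<dots> \<le> q \<bullet> z"
      using that m by (auto simp: nonneg_orthant_def inner_vec_def sum_distrib_left intro!: sum_mono mult_right_mono)
    finally show ?thesis .
  qed
  \<comment> \<open>The growth rate is chosen as \<open>l0 * m / 2\<close>, with \<open>m\<close>
    the least component of \<open>q\<close>: since \<open>m * norm z \<le> q \<bullet> z\<close> on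
    the orthant, this growth costs at most \<open>l / 2 * (q \<bullet> z)\<close>.\<close>
  have "0 < l0 * m / 2" using l0 m by simp
  with sub obtain C where C: "C > 0"
    "\<And>x. x \<in> nonneg_orthant \<Longrightarrow> \<bar>F x\<bar> \<le> C * exp (l0 * m / 2 * norm x)"
    unfolding subexponential_def by blast
  have q0: "0 < (\<Prod>i\<in>UNIV. q $ i)" using q by (auto simp: positive_vec_def intro!: prod_pos)
  show ?thesis
  proof
    \<comment> \<open>The power of 2 comes from integrating with \<open>l / 2\<close> in place of
      \<open>l\<close>.\<close>
    show "0 \<le> C * 2 ^ CARD('n) / (\<Prod>i\<in>UNIV. q $ i)" using C q0 by simp
    fix l assume l: "l0 \<le> l"
    have "(\<integral>\<^sup>+z. ennreal (norm (indicator nonneg_orthant z *\<^sub>R (exp (- (l * (q \<bullet> z))) * F z))) \<partial>lborel)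
       \<le> (\<integral>\<^sup>+z. ennreal C * ennreal (indicator nonneg_orthant z * exp (- (l / 2 * (q \<bullet> z)))) \<partial>lborel)"
    proof (rule nn_integral_mono)
      fix z :: "real ^ 'n"
      show "ennreal (norm (indicator nonneg_orthant z *\<^sub>R (exp (- (l * (q \<bullet> z))) * F z)))
         \<le> ennreal C * ennreal (indicator nonneg_orthant z * exp (- (l / 2 * (q \<bullet> z))))"
      proof (cases "z \<in> nonneg_orthant")
        case True
        have "l0 / 2 * (m * norm z) \<le> l / 2 * (q \<bullet> z)"
          using qz[OF True] l l0 m by (intro mult_mono) auto
        then have le: "- (l * (q \<bullet> z)) + l0 * m / 2 * norm z \<le> - (l / 2 * (q \<bullet> z))"
          by (simp add: field_simps)
        have "exp (- (l * (q \<bullet> z))) * \<bar>F z\<bar> \<le> exp (- (l * (q \<bullet> z))) * (C * exp (l0 * m / 2 * norm z))"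
          using C(2)[OF True] by simp
        also have "\<dots> = C * exp (- (l * (q \<bullet> z)) + l0 * m / 2 * norm z)" by (simp add: mult_exp_exp)
        also have "\<dots> \<le> C * exp (- (l / 2 * (q \<bullet> z)))" using le C by simp
        finally show ?thesis using True C by (simp add: ennreal_mult[symmetric] abs_mult)
      qed simp
    qed
    also have "\<dots> = ennreal C * ennreal ((1 / (l / 2)) ^ CARD('n) / (\<Prod>i\<in>UNIV. q $ i))"
      using l l0 q by (subst nn_integral_cmult, simp, subst nn_integral_exp_minus_orthant) auto
    also have "\<dots> = ennreal (C * 2 ^ CARD('n) / (\<Prod>i\<in>UNIV. q $ i) * (1 / l) ^ CARD('n))"
      using C l l0 q0 by (simp add: ennreal_mult[symmetric] power_divide)
    finally show "(\<integral>\<^sup>+z. ennreal (norm (indicator nonneg_orthant z *\<^sub>R (exp (- (l * (q \<bullet> z))) * F z))) \<partial>lborel)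
        \<le> ennreal (C * 2 ^ CARD('n) / (\<Prod>i\<in>UNIV. q $ i) * (1 / l) ^ CARD('n))" .
  qed
qed

lemma laplace_integrable:
  fixes F :: "real ^ 'n \<Rightarrow> real"
  assumes [measurable]: "F \<in> borel_measurable borel"
    and "subexponential F" "positive_vec q" and l: "0 < l"
  shows "set_integrable lborel nonneg_orthant (\<lambda>z. exp (- (l * (q \<bullet> z))) * F z)"
proof -
  obtain K where "0 \<le> K" and K: "\<And>l'. l \<le> l' \<Longrightarrow> (\<integral>\<^sup>+z. ennreal (norm (indicator nonneg_orthant z *\<^sub>R (exp (- (l' * (q \<bullet> z))) * F z))) \<partial>lborel)
        \<le> ennreal (K * (1 / l') ^ CARD('n))"
    by (rule laplace_nn_bound[OF assms]) (erule that)
  show ?thesis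
    unfolding set_integrable_def integrable_iff_bounded
    using le_less_trans[OF K[OF order_refl] ennreal_less_top] by auto
qed

lemma laplace_bound:
  fixes F :: "real ^ 'n \<Rightarrow> real"
  assumes F: "F \<in> borel_measurable borel"
    and sub: "subexponential F" and q: "positive_vec q" and l0: "0 < l0"
  obtains K where "0 \<le> K" "\<And>l. l0 \<le> l \<Longrightarrow> \<bar>laplace F q l\<bar> \<le> K * (1 / l) ^ CARD('n)"
proof -
  obtain K where K: "0 \<le> K" "\<And>l. l0 \<le> l \<Longrightarrow> (\<integral>\<^sup>+z. ennreal (norm (indicator nonneg_orthant z *\<^sub>R (exp (- (l * (q \<bullet> z))) * F z))) \<partial>lborel)
        \<le> ennreal (K * (1 / l) ^ CARD('n))"
    by (rule laplace_nn_bound[OF assms]) (erule that)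
  show ?thesis
  proof
    fix l assume l: "l0 \<le> l"
    have "ennreal \<bar>laplace F q l\<bar> \<le> ennreal (K * (1 / l) ^ CARD('n))"
      using integral_norm_bound_ennreal[OF laplace_integrable[OF F sub q, of l, unfolded set_integrable_def]] l l0 K(2)[OF l]
      unfolding laplace_def set_lebesgue_integral_def by auto
    then show "\<bar>laplace F q l\<bar> \<le> K * (1 / l) ^ CARD('n)"
      using K(1) l l0 by simp
  qed (rule K(1))
qed

lemma laplace_measurable [measurable (raw)]:
  fixes F :: "real ^ 'n \<Rightarrow> real"
  assumes [measurable]: "F \<in> borel_measurable borel" "g \<in> borel_measurable M"
  shows "(\<lambda>x. laplace F q (g x)) \<in> borel_measurable M"
  unfolding laplace_def set_lebesgue_integral_def by measurable

text \<open>Dominated convergence: \<open>q \<bullet> z \<ge> 0\<close> on the orthant, so the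
  integrand at the endpoint \<open>l0\<close> majorizes all those with
  \<open>l \<ge> l0\<close>.\<close>

lemma continuous_on_laplace:
  fixes F :: "real ^ 'n \<Rightarrow> real"
  assumes [measurable]: "F \<in> borel_measurable borel"
    and sub: "subexponential F" and q: "positive_vec q" and l0: "0 < l0"
  shows "continuous_on {l0..} (laplace F q)"
  unfolding continuous_on_sequentially laplace_def set_lebesgue_integral_def comp_def
proof (intro allI ballI impI, elim conjE)
  fix X :: "nat \<Rightarrow> real" and l assume l: "l \<in> {l0..}" and X: "\<forall>n. X n \<in> {l0..}" "X \<longlonglongrightarrow> l"
  show "(\<lambda>n. LBINT z. indicator nonneg_orthant z *\<^sub>R (exp (- (X n * (q \<bullet> z))) * F z))
     \<longlonglongrightarrow> (LBINT z. indicator nonneg_orthant z *\<^sub>R (exp (- (l * (q \<bullet> z))) * F z))"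
  proof (rule integral_dominated_convergence)
    show "integrable lborel (\<lambda>z. norm (indicator nonneg_orthant z *\<^sub>R (exp (- (l0 * (q \<bullet> z))) * F z)))"
      using laplace_integrable[OF assms] unfolding set_integrable_def by (rule integrable_norm)
    show "AE z in lborel. (\<lambda>n. indicator nonneg_orthant z *\<^sub>R (exp (- (X n * (q \<bullet> z))) * F z))
        \<longlonglongrightarrow> indicator nonneg_orthant z *\<^sub>R (exp (- (l * (q \<bullet> z))) * F z)"
      by (intro AE_I2 tendsto_intros X)
    fix n
    show "AE z in lborel. norm (indicator nonneg_orthant z *\<^sub>R (exp (- (X n * (q \<bullet> z))) * F z))
       \<le> norm (indicator nonneg_orthant z *\<^sub>R (exp (- (l0 * (q \<bullet> z))) * F z))"
    proof (intro AE_I2)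
      fix z :: "real ^ 'n"
      show "norm (indicator nonneg_orthant z *\<^sub>R (exp (- (X n * (q \<bullet> z))) * F z))
         \<le> norm (indicator nonneg_orthant z *\<^sub>R (exp (- (l0 * (q \<bullet> z))) * F z))"
      proof (cases "z \<in> nonneg_orthant")
        case True
        have "0 \<le> q \<bullet> z" using True q
          by (auto simp: inner_vec_def nonneg_orthant_def positive_vec_def less_imp_le intro!: sum_nonneg)
        then have "l0 * (q \<bullet> z) \<le> X n * (q \<bullet> z)" using X by (intro mult_right_mono) auto
        then show ?thesis using True by (simp add: abs_mult mult_right_mono)
      qed simp
    qed
  qed auto
qed

section \<open>The second derivative of the profit as a density\<close>

definition profit_density :: "real \<Rightarrow> (real ^ 'n \<Rightarrow> real) \<Rightarrow> real ^ 'n \<Rightarrow> real \<Rightarrow> real" where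
  "profit_density r F q v = laplace F q (v powr r) / v"

lemma isCont_profit_density:
  fixes F :: "real ^ 'n \<Rightarrow> real"
  assumes F: "F \<in> borel_measurable borel"
    and sub: "subexponential F" and q: "positive_vec q" and v: "0 < v"
  shows "isCont (profit_density r F q) v"
proof -
  have pos: "0 < v powr r" using v by simp
  \<comment> \<open>Continuity of \<open>laplace\<close> is known on closed half-lines away from
    \<open>0\<close>; starting one at half the point makes the point interior.\<close>
  have "v powr r \<in> interior {v powr r / 2..}" using pos by simp
  then have "isCont (laplace F q) (v powr r)"
    using continuous_on_laplace[OF F sub q, of "v powr r / 2"] pos by (intro continuous_on_interior) auto
  then have "isCont (\<lambda>v. laplace F q (v powr r)) v"
    by (rule isCont_o2 [rotated]) (use v in \<open>auto intro!: continuous_intros\<close>)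
  then show ?thesis unfolding profit_density_def using v by (intro continuous_intros) auto
qed

text \<open>For \<open>v \<le> b\<close> the argument \<open>v powr r\<close> stays above
  \<open>b powr r\<close>, so a single constant \<open>K\<close> serves. The decay of
  \<open>laplace\<close> then bounds the density by \<open>K * v powr (- r * n - 1)\<close> with
  \<open>n\<close> the dimension, and this exponent exceeds \<open>- 1\<close> because
  \<open>r < 0\<close>.\<close>

lemma profit_density_integrable:
  fixes F :: "real ^ 'n \<Rightarrow> real"
  assumes F [measurable]: "F \<in> borel_measurable borel"
    and sub: "subexponential F" and q: "positive_vec q" and r: "r < 0" and b: "0 < b"
  shows "set_integrable lborel {0..b} (profit_density r F q)"
proof -
  let ?a = "- r * real CARD('n) - 1"
  obtain K where K: "0 \<le> K" "\<And>l. b powr r \<le> l \<Longrightarrow> \<bar>laplace F q l\<bar> \<le> K * (1 / l) ^ CARD('n)"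
    by (rule laplace_bound[OF F sub q, of "b powr r"]) (use b in auto)
  have a: "?a > -1" using r by (simp add: mult_neg_pos)
  have "(\<lambda>x. x powr ?a) integrable_on {0..b}"
    by (rule integrable_on_powr_from_0) (use a b in auto)
  then have "(\<lambda>x. x powr ?a) absolutely_integrable_on {0..b}"
    by (subst absolutely_integrable_on_iff_nonneg) auto
  then have "integrable lborel (\<lambda>x. indicator {0..b} x *\<^sub>R (x powr ?a))"
    unfolding set_integrable_def by (subst (asm) integrable_completion) auto
  then have int: "integrable lborel (\<lambda>x. K * (indicator {0..b} x *\<^sub>R (x powr ?a)))"
    by (rule integrable_mult_right)
  have [measurable]: "profit_density r F q \<in> borel_measurable borel" unfolding profit_density_def by measurable
  show ?thesis unfolding set_integrable_def
  proof (rule Bochner_Integration.integrable_bound[OF int])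
    show "AE v in lborel. norm (indicator {0..b} v *\<^sub>R profit_density r F q v)
        \<le> norm (K * (indicator {0..b} v *\<^sub>R (v powr ?a)))"
    proof (intro AE_I2)
      fix v :: real
      show "norm (indicator {0..b} v *\<^sub>R profit_density r F q v) \<le> norm (K * (indicator {0..b} v *\<^sub>R (v powr ?a)))"
      proof (cases "0 < v \<and> v \<le> b")
        case True
        then have "b powr r \<le> v powr r" using r by (intro powr_mono2') auto
        then have "\<bar>profit_density r F q v\<bar> \<le> K * (1 / v powr r) ^ CARD('n) / v"
          using K(2) True unfolding profit_density_def by (simp add: divide_right_mono)
        also have "\<dots> = K * v powr ?a"
          using True by (simp add: powr_diff powr_minus powr_powr power_one_over field_simps flip: powr_realpow)
        finally show ?thesis using True K by simp
      qed (auto simp: profit_density_def indicator_def)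
    qed
  qed auto
qed

section \<open>Convergence of the inner integral of \<open>phi\<close>\<close>

lemma positive_vec_powr: "positive_vec p \<Longrightarrow> positive_vec (\<chi> i. (p $ i) powr a)"
  by (auto simp: positive_vec_def less_le)

text \<open>This is the norm of the integrand of Euler's Gamma integral at \<open>k + 1\<close>,
  with rate \<open>1 / 2\<close> in the exponential.\<close>

lemma integrable_power_exp_half:
  "integrable lborel (\<lambda>t. indicator {0<..} t * (t ^ k * exp (- (t / 2)) :: real))"
proof -
  have "(\<lambda>t. complex_of_real t powr (of_nat k + 1 - 1) / of_real (exp (1 / 2 * t))) absolutely_integrable_on {0<..}"
    by (rule absolutely_integrable_Gamma_integral) auto
  then have "integrable lebesgue (\<lambda>t. norm (indicator {0<..} t *\<^sub>R (complex_of_real t powr (of_nat k + 1 - 1) / of_real (exp (1 / 2 * t)))))"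
    unfolding set_integrable_def by (rule integrable_norm)
  also have "(\<lambda>t. norm (indicator {0<..} t *\<^sub>R (complex_of_real t powr (of_nat k + 1 - 1) / of_real (exp (1 / 2 * t)))))
      = (\<lambda>t. indicator {0<..} t * (t ^ k * exp (- (t / 2))))"
    by (rule ext) (auto simp: indicator_def powr_nat norm_divide norm_power exp_minus field_simps)
  finally show ?thesis by (subst (asm) integrable_completion) auto
qed

lemma integrable_power_exp_ray:
  fixes F :: "real ^ 'n \<Rightarrow> real"
  assumes [measurable]: "F \<in> borel_measurable borel"
    and sub: "subexponential F" and y: "y \<in> nonneg_orthant"
  shows "set_integrable lborel {0..} (\<lambda>t. t ^ k * exp (- t) * F (\<chi> i. t * y $ i))"
proof -
  \<comment> \<open>With this rate \<open>F\<close> grows along the ray through \<open>y\<close> at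
    most like \<open>exp (t / 2)\<close>, which leaves \<open>exp (- (t / 2))\<close> of the weight.
    The summand 1 keeps the denominator positive for \<open>y = 0\<close>.\<close>
  have "0 < 1 / (2 * (1 + norm y))" using norm_ge_zero[of y] by (simp add: add_pos_nonneg)
  with sub obtain C where C: "C > 0"
    "\<And>x. x \<in> nonneg_orthant \<Longrightarrow> \<bar>F x\<bar> \<le> C * exp (1 / (2 * (1 + norm y)) * norm x)"
    unfolding subexponential_def by blast
  have int: "integrable lborel (\<lambda>t. C * (indicator {0<..} t * (t ^ k * exp (- (t / 2)))))"
    by (intro integrable_mult_right integrable_power_exp_half)
  show ?thesis unfolding set_integrable_def
  proof (rule Bochner_Integration.integrable_bound[OF int])
    show "AE t in lborel. norm (indicator {0..} t *\<^sub>R (t ^ k * exp (- t) * F (\<chi> i. t * y $ i)))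
        \<le> norm (C * (indicator {0<..} t * (t ^ k * exp (- (t / 2)))))"
      using AE_lborel_singleton[of "0 :: real"]
    proof eventually_elim
      fix t :: real assume "t \<noteq> 0"
      show "norm (indicator {0..} t *\<^sub>R (t ^ k * exp (- t) * F (\<chi> i. t * y $ i)))
        \<le> norm (C * (indicator {0<..} t * (t ^ k * exp (- (t / 2)))))"
      proof (cases "0 < t")
        case True
        have eq: "(\<chi> i. t * y $ i) = t *\<^sub>R y" by (simp add: vec_eq_iff)
        have "(\<chi> i. t * y $ i) \<in> nonneg_orthant" using y True by (simp add: nonneg_orthant_def)
        then have "\<bar>F (\<chi> i. t * y $ i)\<bar> \<le> C * exp (1 / (2 * (1 + norm y)) * norm (t *\<^sub>R y))"
          using C(2) eq by metis
        also have "1 / (2 * (1 + norm y)) * norm (t *\<^sub>R y) = t / 2 * (norm y / (1 + norm y))"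
          using True norm_ge_zero[of y] by (simp add: field_simps add_nonneg_eq_0_iff)
        also have "\<dots> \<le> t / 2 * 1"
          using True norm_ge_zero[of y] by (intro mult_left_mono) (auto simp: divide_le_eq_1 add_pos_nonneg)
        finally have F: "\<bar>F (\<chi> i. t * y $ i)\<bar> \<le> C * exp (t / 2)" using C by simp
        have "exp (- t) * \<bar>F (\<chi> i. t * y $ i)\<bar> \<le> exp (- t) * (C * exp (t / 2))"
          using F by simp
        also have "\<dots> = C * exp (- (t / 2))" by (simp add: mult_exp_exp)
        finally have "t ^ k * (exp (- t) * \<bar>F (\<chi> i. t * y $ i)\<bar>) \<le> t ^ k * (C * exp (- (t / 2)))"
          using True by (intro mult_left_mono) auto
        then show ?thesis using True C by (simp add: abs_mult mult_ac)
      qed (use \<open>t \<noteq> 0\<close> in auto)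
    qed
  qed auto
qed

lemma phi_measurable [measurable]:
  fixes F :: "real ^ 'n \<Rightarrow> real"
  assumes [measurable]: "F \<in> borel_measurable borel"
  shows "phi r F \<in> borel_measurable borel"
  unfolding phi_def set_lebesgue_integral_def by measurable

lemma powr_vec_nonneg_orthant: "(\<chi> i. (x $ i) powr a) \<in> nonneg_orthant"
  by (simp add: nonneg_orthant_def)

text \<open>Both inner integrals converge, so they may be subtracted. This works at every
  \<open>x\<close>, since the vector of powers lies in the orthant whatever the signs of the
  components of \<open>x\<close>.\<close>

lemma phi_diff:
  fixes F G :: "real ^ 'n \<Rightarrow> real"
  assumes "F \<in> borel_measurable borel" "G \<in> borel_measurable borel"
    and "subexponential F" "subexponential G"
  shows "phi r (\<lambda>x. F x - G x) x = phi r F x - phi r G x"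
  using integrable_power_exp_ray[OF assms(1,3) powr_vec_nonneg_orthant, of "CARD('n) - 1" x "- r"]
    integrable_power_exp_ray[OF assms(2,4) powr_vec_nonneg_orthant, of "CARD('n) - 1" x "- r"]
  unfolding phi_def by (simp add: right_diff_distrib)

section \<open>The profit integral for functions of either sign\<close>

lemma weighted_profit_density_integrable:
  fixes F :: "real ^ 'n \<Rightarrow> real"
  assumes F [measurable]: "F \<in> borel_measurable borel"
    and sub: "subexponential F" and q: "positive_vec q" and r: "r < 0" and c: "0 < c"
  shows "set_integrable lborel {0..c} (\<lambda>v. (c - v) * profit_density r F q v)"
  unfolding set_integrable_def
proof (rule Bochner_Integration.integrable_bound)
  show "integrable lborel (\<lambda>v. c * (indicator {0..c} v *\<^sub>R profit_density r F q v))"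
    using profit_density_integrable[OF F sub q r c] unfolding set_integrable_def by (rule integrable_mult_right)
  show "AE v in lborel. norm (indicator {0..c} v *\<^sub>R ((c - v) * profit_density r F q v))
     \<le> norm (c * (indicator {0..c} v *\<^sub>R profit_density r F q v))"
    by (rule AE_I2) (auto simp: indicator_def abs_mult intro!: mult_right_mono)
qed (simp add: profit_density_def)

text \<open>The right-hand side of \<open>nn_integral_profit\<close> is finite by integrability of
  the density, hence so is the left. The form \<open>has_bochner_integral\<close> keeps this
  integrability, which the later subtraction needs.\<close>

lemma profit_integral_nonneg:
  fixes F :: "real ^ 'n \<Rightarrow> real"
  assumes F [measurable]: "F \<in> borel_measurable borel" and nonneg: "\<And>x. 0 \<le> F x"
    and sub: "subexponential F" and p: "positive_vec p" and r: "r < 0" and c: "0 < c"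
  defines "q \<equiv> \<chi> i. (p $ i) powr (- r)"
  shows "has_bochner_integral lborel
     (\<lambda>x. indicator nonneg_orthant x *\<^sub>R (max (c - h_fun r (p * x)) 0 * phi r F x))
     (LBINT v:{0..c}. (c - v) * profit_density r F q v)"
proof (rule has_bochner_integral_nn_integral)
  let ?W = "{x :: real ^ 'n. positive_vec x}"
  define T where "T = (\<lambda>x :: real ^ 'n. LBINT t:{0..}. t ^ (CARD('n) - 1) * exp (- t) * F (\<chi> i. t * (x $ i) powr (- r)))"
  have q: "positive_vec q" using p unfolding q_def by (rule positive_vec_powr)
  have T0: "0 \<le> T x" for x
    unfolding T_def set_lebesgue_integral_def by (intro integral_nonneg_AE AE_I2) (auto simp: indicator_def nonneg)
  have [measurable]: "(\<lambda>x. h_fun r (p * x)) \<in> borel_measurable borel"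
    unfolding h_fun_def by simp
  show "(\<lambda>x. indicator nonneg_orthant x *\<^sub>R (max (c - h_fun r (p * x)) 0 * phi r F x)) \<in> borel_measurable lborel"
    by simp
  have phi: "phi r F x = (- r) ^ (CARD('n) - 1) * (\<Prod>i\<in>UNIV. x $ i) powr (- r - 1) * T x" for x
    unfolding phi_def T_def ..
  show "AE x in lborel. 0 \<le> indicator nonneg_orthant x *\<^sub>R (max (c - h_fun r (p * x)) 0 * phi r F x)"
    using T0 r by (simp add: phi)
  have dens0: "0 \<le> profit_density r F q v" if "0 \<le> v" for v
    unfolding profit_density_def laplace_def set_lebesgue_integral_def using that
    by (intro divide_nonneg_nonneg integral_nonneg_AE AE_I2) (auto simp: indicator_def nonneg)
  then have "0 \<le> indicator {0..c} v *\<^sub>R ((c - v) * profit_density r F q v)" for v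
    by (auto simp: indicator_def)
  then show "0 \<le> (LBINT v:{0..c}. (c - v) * profit_density r F q v)"
    unfolding set_lebesgue_integral_def by (intro integral_nonneg_AE AE_I2)
  have TT: "ennreal (T x) = (\<integral>\<^sup>+t. ennreal (indicator {0<..} t * (t ^ (CARD('n) - 1) * exp (- t) * F (\<chi> i. t * (x $ i) powr (- r)))) \<partial>lborel)" for x
  proof -
    have "(\<integral>\<^sup>+t. ennreal (indicator {0<..} t * (t ^ (CARD('n) - 1) * exp (- t) * F (\<chi> i. t * (x $ i) powr (- r)))) \<partial>lborel)
      = (\<integral>\<^sup>+t. ennreal (indicator {0..} t *\<^sub>R (t ^ (CARD('n) - 1) * exp (- t) * F (\<chi> i. t * (x $ i) powr (- r)))) \<partial>lborel)"
      by (rule nn_integral_cong_AE, use AE_lborel_singleton[of "0 :: real"] in eventually_elim)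
         (auto simp: indicator_def)
    also have "\<dots> = ennreal (T x)"
      unfolding T_def set_lebesgue_integral_def
      using integrable_power_exp_ray[OF F sub powr_vec_nonneg_orthant, of "CARD('n) - 1" x "- r"]
      by (intro nn_integral_eq_integral) (auto simp: set_integrable_def indicator_def nonneg)
    finally show ?thesis ..
  qed
  have "(\<integral>\<^sup>+x. ennreal (indicator nonneg_orthant x *\<^sub>R (max (c - h_fun r (p * x)) 0 * phi r F x)) \<partial>lborel)
    = (\<integral>\<^sup>+x. indicator ?W x *
           ennreal (max (c - (\<Sum>i\<in>UNIV. q $ i * (x $ i) powr (- r)) powr (1 / - r)) 0 *
             ((- r) ^ (CARD('n) - 1) * (\<Prod>i\<in>UNIV. x $ i) powr (- r - 1))) *
           (\<integral>\<^sup>+t. ennreal (indicator {0<..} t * (t ^ (CARD('n) - 1) * exp (- t) * F (\<chi> i. t * (x $ i) powr (- r)))) \<partial>lborel) \<partial>lborel)"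
  proof (rule nn_integral_cong_AE, use AE_nonneg_orthant_iff_positive in eventually_elim)
    fix x :: "real ^ 'n" assume iff: "x \<in> nonneg_orthant \<longleftrightarrow> positive_vec x"
    have h: "h_fun r (p * x) = (\<Sum>i\<in>UNIV. q $ i * (x $ i) powr (- r)) powr (1 / - r)" if "positive_vec x"
      using p that unfolding h_fun_def q_def positive_vec_def by (simp add: powr_mult less_imp_le)
    show "ennreal (indicator nonneg_orthant x *\<^sub>R (max (c - h_fun r (p * x)) 0 * phi r F x)) =
       indicator ?W x *
           ennreal (max (c - (\<Sum>i\<in>UNIV. q $ i * (x $ i) powr (- r)) powr (1 / - r)) 0 *
             ((- r) ^ (CARD('n) - 1) * (\<Prod>i\<in>UNIV. x $ i) powr (- r - 1))) *
           (\<integral>\<^sup>+t. ennreal (indicator {0<..} t * (t ^ (CARD('n) - 1) * exp (- t) * F (\<chi> i. t * (x $ i) powr (- r)))) \<partial>lborel)"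
      unfolding TT[symmetric] phi using iff h T0[of x] r
      by (cases "positive_vec x") (auto simp: ennreal_mult[symmetric] mult_ac)
  qed
  also have "\<dots> = (\<integral>\<^sup>+v. ennreal (indicator {0<..} v * (max (c - v) 0 / v)) *
           (\<integral>\<^sup>+z. ennreal (indicator ?W z * F z * exp (- (v powr (- (- r)) * (q \<bullet> z)))) \<partial>lborel) \<partial>lborel)"
    by (rule nn_integral_profit) (use r q nonneg in auto)
  also have "\<dots> = (\<integral>\<^sup>+v. ennreal (indicator {0..c} v *\<^sub>R ((c - v) * profit_density r F q v)) \<partial>lborel)"
  proof (rule nn_integral_cong)
    fix v :: real
    show "ennreal (indicator {0<..} v * (max (c - v) 0 / v)) *
           (\<integral>\<^sup>+z. ennreal (indicator ?W z * F z * exp (- (v powr (- (- r)) * (q \<bullet> z)))) \<partial>lborel)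
        = ennreal (indicator {0..c} v *\<^sub>R ((c - v) * profit_density r F q v))"
    proof (cases "0 < v")
      case True
      have "(\<integral>\<^sup>+z. ennreal (indicator ?W z * F z * exp (- (v powr (- (- r)) * (q \<bullet> z)))) \<partial>lborel)
         = (\<integral>\<^sup>+z. ennreal (indicator nonneg_orthant z *\<^sub>R (exp (- (v powr r * (q \<bullet> z))) * F z)) \<partial>lborel)"
        by (rule nn_integral_cong_AE, use AE_nonneg_orthant_iff_positive in eventually_elim)
           (auto simp: indicator_def mult_ac)
      also have "\<dots> = ennreal (laplace F q (v powr r))"
        unfolding laplace_def set_lebesgue_integral_def
        using laplace_integrable[OF F sub q, of "v powr r"] True
        by (intro nn_integral_eq_integral) (auto simp: set_integrable_def indicator_def nonneg)
      also have "laplace F q (v powr r) = v * profit_density r F q v" using True by (simp add: profit_density_def)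
      finally show ?thesis using True dens0[of v]
        by (auto simp: ennreal_mult[symmetric] indicator_def max_def)
    qed (auto simp: profit_density_def indicator_def)
  qed
  also have "\<dots> = ennreal (LBINT v:{0..c}. (c - v) * profit_density r F q v)"
    using weighted_profit_density_integrable[OF F sub q r c] dens0
    unfolding set_integrable_def set_lebesgue_integral_def
    by (intro nn_integral_eq_integral) (auto simp: indicator_def)
  finally show "(\<integral>\<^sup>+x. ennreal (indicator nonneg_orthant x *\<^sub>R (max (c - h_fun r (p * x)) 0 * phi r F x)) \<partial>lborel)
    = ennreal (LBINT v:{0..c}. (c - v) * profit_density r F q v)" .
qed

lemma profit_density_diff:
  fixes F G :: "real ^ 'n \<Rightarrow> real"
  assumes "F \<in> borel_measurable borel" "G \<in> borel_measurable borel"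
    and "subexponential F" "subexponential G" and q: "positive_vec q"
  shows "profit_density r (\<lambda>x. F x - G x) q v = profit_density r F q v - profit_density r G q v"
\<comment> \<open>At \<open>v = 0\<close> the integrals defining \<open>laplace\<close> need not
  converge, but division by zero makes all three densities \<open>0\<close>.\<close>
proof (cases "v = 0")
  case False
  then have "0 < v powr r" by simp
  then show ?thesis
    using laplace_integrable[OF assms(1,3) q, of "v powr r"] laplace_integrable[OF assms(2,4) q, of "v powr r"]
    unfolding profit_density_def laplace_def by (simp add: right_diff_distrib diff_divide_distrib)
qed (simp add: profit_density_def)

text \<open>The positive and negative parts of \<open>F\<close> are again measurable and
  subexponential, and both sides respect their difference.\<close>

lemma profit_integral:
  fixes F :: "real ^ 'n \<Rightarrow> real"
  assumes F [measurable]: "F \<in> borel_measurable borel"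
    and sub: "subexponential F" and p: "positive_vec p" and r: "r < 0" and c: "0 < c"
  defines "q \<equiv> \<chi> i. (p $ i) powr (- r)"
  shows "(LBINT x:nonneg_orthant. max (c - h_fun r (p * x)) 0 * phi r F x)
      = (LBINT v:{0..c}. (c - v) * profit_density r F q v)"
proof -
  define Fp Fm where "Fp = (\<lambda>x. max (F x) 0)" and "Fm = (\<lambda>x. max (- F x) 0)"
  have F_eq: "F = (\<lambda>x. Fp x - Fm x)" by (auto simp: Fp_def Fm_def)
  have M: "Fp \<in> borel_measurable borel" "Fm \<in> borel_measurable borel"
    unfolding Fp_def Fm_def by measurable
  have "\<bar>Fp x\<bar> \<le> \<bar>F x\<bar>" "\<bar>Fm x\<bar> \<le> \<bar>F x\<bar>" for x by (auto simp: Fp_def Fm_def)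
  then have S: "subexponential Fp" "subexponential Fm"
    using sub unfolding subexponential_def by (meson order_trans)+
  have q: "positive_vec q" using p unfolding q_def by (rule positive_vec_powr)
  have eq: "indicator nonneg_orthant x *\<^sub>R (max (c - h_fun r (p * x)) 0 * phi r Fp x)
        - indicator nonneg_orthant x *\<^sub>R (max (c - h_fun r (p * x)) 0 * phi r Fm x)
     = indicator nonneg_orthant x *\<^sub>R (max (c - h_fun r (p * x)) 0 * phi r F x)" for x
    unfolding F_eq phi_diff[OF M S] by (simp add: algebra_simps)
  have "has_bochner_integral lborel
     (\<lambda>x. indicator nonneg_orthant x *\<^sub>R (max (c - h_fun r (p * x)) 0 * phi r F x))
     ((LBINT v:{0..c}. (c - v) * profit_density r Fp q v) - (LBINT v:{0..c}. (c - v) * profit_density r Fm q v))"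
    unfolding eq[symmetric] q_def
    by (intro has_bochner_integral_diff profit_integral_nonneg M S p r c) (auto simp: Fp_def Fm_def)
  also have "(LBINT v:{0..c}. (c - v) * profit_density r Fp q v) - (LBINT v:{0..c}. (c - v) * profit_density r Fm q v)
     = (LBINT v:{0..c}. (c - v) * profit_density r F q v)"
    unfolding F_eq profit_density_diff[OF M S q] right_diff_distrib
    using weighted_profit_density_integrable[OF M(1) S(1) q r c] weighted_profit_density_integrable[OF M(2) S(2) q r c]
    by (rule set_integral_diff(2)[symmetric])
  finally show ?thesis
    unfolding set_lebesgue_integral_def by (rule has_bochner_integral_integral_eq)
qed

section \<open>Double primitives of functions integrable at 0 and continuous on the positive
  half-line\<close>

lemma integral_from_0_has_derivative:
  assumes h: "\<And>b. (h :: real \<Rightarrow> real) integrable_on {0..b}" and h': "isCont h u" and u: "0 < u"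
  shows "((\<lambda>u. integral {0..u} h) has_real_derivative h u) (at u)"
proof -
  \<comment> \<open>The interval is extended to \<open>u + 1\<close> so that \<open>u\<close> is
    interior and the derivative is two-sided.\<close>
  have "((\<lambda>u. integral {0..u} h) has_vector_derivative h u) (at u within {0..u+1} - {})"
    by (rule integral_has_vector_derivative_continuous_at)
       (use h h' u in \<open>auto intro: continuous_at_imp_continuous_at_within\<close>)
  then show ?thesis using u
    by (simp add: has_real_derivative_iff_has_vector_derivative at_within_Icc_at)
qed

lemma integral_from_0_tendsto_0:
  assumes h: "(h :: real \<Rightarrow> real) integrable_on {0..1}"
  shows "((\<lambda>u. integral {0..u} h) \<longlongrightarrow> 0) (at_right 0)"
proof -
  have "continuous_on {0..1} (\<lambda>u. integral {0..u} h)"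
    by (rule indefinite_integral_continuous_1[OF h])
  then have "((\<lambda>u. integral {0..u} h) \<longlongrightarrow> integral {0..0} h) (at 0 within {0..1})"
    unfolding continuous_on_def by (rule bspec) simp
  then show ?thesis by (simp add: at_within_Icc_at_right)
qed

lemma eventually_nhds_pos: "0 < (u :: real) \<Longrightarrow> eventually (\<lambda>x. 0 < x) (nhds u)"
  using eventually_nhds_in_open[of "{0<..}" u] by simp

context
  fixes g :: "real \<Rightarrow> real"
  assumes int: "\<And>b. 0 < b \<Longrightarrow> set_integrable lborel {0..b} g"
    and cont: "\<And>v. 0 < v \<Longrightarrow> isCont g v"
begin

lemma weighted_set_integrable:
  assumes b: "0 < b"
  shows "set_integrable lborel {0..b} (\<lambda>v. v * g v)"
  unfolding set_integrable_def
proof (rule Bochner_Integration.integrable_bound)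
  show "integrable lborel (\<lambda>v. b * (indicator {0..b} v *\<^sub>R g v))"
    using int[OF b] unfolding set_integrable_def by (rule integrable_mult_right)
  have "(\<lambda>v. v * (indicator {0..b} v *\<^sub>R g v)) \<in> borel_measurable lborel"
    using int[OF b] unfolding set_integrable_def by measurable
  also have "(\<lambda>v. v * (indicator {0..b} v *\<^sub>R g v)) = (\<lambda>v. indicator {0..b} v *\<^sub>R (v * g v))"
    by (simp add: mult_ac)
  finally show "(\<lambda>v. indicator {0..b} v *\<^sub>R (v * g v)) \<in> borel_measurable lborel" .
  show "AE v in lborel. norm (indicator {0..b} v *\<^sub>R (v * g v)) \<le> norm (b * (indicator {0..b} v *\<^sub>R g v))"
    by (rule AE_I2) (auto simp: indicator_def abs_mult intro!: mult_right_mono)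
qed

lemma integrable_on_from_0: "g integrable_on {0..b}" "(\<lambda>v. v * g v) integrable_on {0..b}"
proof -
  have "g integrable_on {0..b} \<and> (\<lambda>v. v * g v) integrable_on {0..b}"
  proof (cases "0 < b")
    case True
    then show ?thesis
      using set_borel_integral_eq_integral(1)[OF int] set_borel_integral_eq_integral(1)[OF weighted_set_integrable]
      by blast
  next
    case False
    then have "{0..b} = {} \<or> {0..b} = {0}" by auto
    then show ?thesis by (auto simp: integrable_on_refl[of _ 0, simplified])
  qed
  then show "g integrable_on {0..b}" "(\<lambda>v. v * g v) integrable_on {0..b}" by auto
qed

lemma double_primitive_eq:
  assumes u: "0 < u"
  shows "(LBINT v:{0..u}. (u - v) * g v) = u * integral {0..u} g - integral {0..u} (\<lambda>v. v * g v)"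
proof -
  have "(LBINT v:{0..u}. (u - v) * g v) = (LBINT v:{0..u}. u * g v - v * g v)"
    by (simp add: left_diff_distrib)
  also have "\<dots> = u * (LBINT v:{0..u}. g v) - (LBINT v:{0..u}. v * g v)"
    using int[OF u] weighted_set_integrable[OF u] by simp
  finally show ?thesis
    using set_borel_integral_eq_integral(2)[OF int[OF u]]
      set_borel_integral_eq_integral(2)[OF weighted_set_integrable[OF u]] by simp
qed

text \<open>Expanding \<open>(u - v) * g v\<close> moves the parameter out of the integrand. After
  differentiation the two boundary terms \<open>u * g u\<close> cancel.\<close>

lemma double_primitive_has_derivative:
  assumes u: "0 < u"
  shows "((\<lambda>u. LBINT v:{0..u}. (u - v) * g v) has_real_derivative integral {0..u} g) (at u)"
proof -
  have "((\<lambda>u. u * integral {0..u} g - integral {0..u} (\<lambda>v. v * g v)) has_real_derivative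
      (1 * integral {0..u} g + g u * u) - u * g u) (at u)"
    by (intro DERIV_diff DERIV_mult DERIV_ident integral_from_0_has_derivative integrable_on_from_0)
       (use u cont in \<open>auto intro!: continuous_intros\<close>)
  then have "((\<lambda>u. u * integral {0..u} g - integral {0..u} (\<lambda>v. v * g v)) has_real_derivative
      integral {0..u} g) (at u)" by (simp add: mult.commute)
  moreover have "eventually (\<lambda>u. (LBINT v:{0..u}. (u - v) * g v) =
      u * integral {0..u} g - integral {0..u} (\<lambda>v. v * g v)) (nhds u)"
    using eventually_nhds_pos[OF u] by eventually_elim (rule double_primitive_eq)
  ultimately show ?thesis by (simp add: DERIV_cong_ev)
qed

lemma double_primitive_tendsto_0:
  "((\<lambda>u. LBINT v:{0..u}. (u - v) * g v) \<longlongrightarrow> 0) (at_right 0)"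
proof -
  have "((\<lambda>u. u * integral {0..u} g - integral {0..u} (\<lambda>v. v * g v)) \<longlongrightarrow> 0 * 0 - 0) (at_right 0)"
    by (intro tendsto_intros integral_from_0_tendsto_0 integrable_on_from_0)
  moreover have "eventually (\<lambda>u. (LBINT v:{0..u}. (u - v) * g v) =
      u * integral {0..u} g - integral {0..u} (\<lambda>v. v * g v)) (at_right 0)"
    using eventually_at_right_less[of "0 :: real"] by eventually_elim (rule double_primitive_eq)
  ultimately show ?thesis by (simp add: tendsto_cong)
qed

end

text \<open>On the connected half-line \<open>E\<close> is constant, and the limit at
  \<open>0\<close> identifies the constant. This is the uniqueness argument for the converse, used
  once for the first derivatives and once for the functions.\<close>

lemma eq_0_if_derivative_0:
  fixes E :: "real \<Rightarrow> real"
  assumes E: "\<And>u. 0 < u \<Longrightarrow> (E has_real_derivative 0) (at u)"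
    and lim: "(E \<longlongrightarrow> 0) (at_right 0)" and u: "0 < u"
  shows "E u = 0"
proof -
  have "\<exists>c. \<forall>x\<in>{0<..}. E x = c"
    by (rule has_field_derivative_zero_constant) (auto intro: E has_field_derivative_at_within)
  then obtain c where c: "\<And>x. 0 < x \<Longrightarrow> E x = c" by auto
  have "(E \<longlongrightarrow> c) (at_right 0)"
    by (rule tendsto_eventually, use eventually_at_right_less[of "0 :: real"] in eventually_elim) (rule c)
  then have "c = 0" using lim by (intro tendsto_unique[of "at_right (0 :: real)"]) auto
  then show ?thesis using c u by simp
qed

section \<open>Homogeneity and the equivalence\<close>

lemma h_fun_scale:
  fixes y :: "real ^ 'n"
  assumes y: "y \<in> nonneg_orthant" and r: "r < 0" and a: "0 < a"
  shows "h_fun r (\<chi> i. y $ i / a) = h_fun r y / a"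
proof -
  have "(\<Sum>i\<in>UNIV. (y $ i / a) powr (- r)) = (\<Sum>i\<in>UNIV. (y $ i) powr (- r)) / a powr (- r)"
    using y a by (simp add: powr_divide nonneg_orthant_def sum_divide_distrib)
  then show ?thesis
    using r a unfolding h_fun_def
    by (simp add: powr_divide powr_powr sum_nonneg)
qed

theorem proposition4p1:
  fixes r :: real
    and f :: "real ^ 'n \<Rightarrow> real"
    and P :: "real ^ 'n \<Rightarrow> real \<Rightarrow> real"
  assumes "- 1 \<le> r" and "r < 0"
    and "continuous_on nonneg_orthant f"
    and "\<And>A. A > 0 \<Longrightarrow> \<exists>C>0. \<forall>x\<in>nonneg_orthant. \<bar>f x\<bar> \<le> C * exp (A * norm x)"
  shows "(\<forall>p p0. positive_vec p \<longrightarrow> p0 > 0 \<longrightarrow>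
            P p p0 = (LBINT x:nonneg_orthant. max (p0 - h_fun r (p * x)) 0 * phi r f x))
     \<longleftrightarrow>
         (\<forall>p. positive_vec p \<longrightarrow>
            (P p \<longlongrightarrow> 0) (at_right 0) \<and>
            (\<forall>p0>0. P p differentiable (at p0)) \<and>
            (deriv (P p) \<longlongrightarrow> 0) (at_right 0)) \<and>
         (\<forall>p p0. positive_vec p \<longrightarrow> p0 > 0 \<longrightarrow>
            P p p0 = p0 * P (\<chi> i. p $ i / p0) 1) \<and>
         (\<forall>p. positive_vec p \<longrightarrow>
            (deriv (P (\<chi> i. (p $ i) powr (- 1 / r))) has_real_derivative
               (LBINT x:nonneg_orthant. exp (- (p \<bullet> x)) * f x)) (at 1))"
proof -
  \<comment> \<open>Outside the orthant \<open>f\<close> is arbitrary, possibly not measurable. Its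
    extension by zero is Borel and gives the same \<open>phi\<close> and the same Laplace
    integrals.\<close>
  define F where "F = (\<lambda>z. indicator nonneg_orthant z *\<^sub>R f z)"
  have F: "F \<in> borel_measurable borel"
    unfolding F_def using assms(3) by (intro borel_measurable_continuous_on_indicator) auto
  have F_eq: "F z = f z" if "z \<in> nonneg_orthant" for z using that by (simp add: F_def)
  have sub: "subexponential F"
    using assms(4) by (simp add: subexponential_def F_eq)
  have phi_eq: "phi r f = phi r F"
  proof
    fix x
    have "F (\<chi> i. t * (x $ i) powr (- r)) = f (\<chi> i. t * (x $ i) powr (- r))" if "0 \<le> t" for t
      by (rule F_eq) (use that in \<open>simp add: nonneg_orthant_def\<close>)
    then have "(LBINT t:{0..}. t ^ (CARD('n) - 1) * exp (- t) * f (\<chi> i. t * (x $ i) powr - r)) =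
        (LBINT t:{0..}. t ^ (CARD('n) - 1) * exp (- t) * F (\<chi> i. t * (x $ i) powr - r))"
      by (intro set_lebesgue_integral_cong) auto
    then show "phi r f x = phi r F x" by (simp add: phi_def)
  qed
  have laplace_eq: "(LBINT x:nonneg_orthant. exp (- (p \<bullet> x)) * f x) = laplace F p 1" for p
    unfolding laplace_def by (rule set_lebesgue_integral_cong) (auto simp: F_eq)
  \<comment> \<open>On positive vectors \<open>Q\<close> is inverse to the power map with exponent
    \<open>- 1 / r\<close> in condition 3.\<close>
  define Q where "Q = (\<lambda>p :: real ^ 'n. \<chi> i. (p $ i) powr (- r))"
  define \<Phi> where "\<Phi> = (\<lambda>p u. LBINT v:{0..u}. (u - v) * profit_density r F (Q p) v)"
  define G where "G = (\<lambda>p u. integral {0..u} (profit_density r F (Q p)))"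
  have Q: "positive_vec (Q p)" if "positive_vec p" for p
    unfolding Q_def using that by (rule positive_vec_powr)
  have scale: "positive_vec (\<chi> i. p $ i / a)" if "positive_vec p" "0 < a" for p :: "real ^ 'n" and a
    using that by (simp add: positive_vec_def)
  note int = profit_density_integrable[OF F sub Q \<open>r < 0\<close>] and cont = isCont_profit_density[OF F sub Q]
  have \<Phi>_eq: "(LBINT x:nonneg_orthant. max (p0 - h_fun r (p * x)) 0 * phi r f x) = \<Phi> p p0"
    if "positive_vec p" "0 < p0" for p p0
    unfolding phi_eq \<Phi>_def Q_def by (rule profit_integral[OF F sub that(1) \<open>r < 0\<close> that(2)])
  have \<Phi>_deriv: "(\<Phi> p has_real_derivative G p u) (at u)" if "positive_vec p" "0 < u" for p u
    unfolding \<Phi>_def G_def by (rule double_primitive_has_derivative[OF int[OF that(1)] cont[OF that(1)] that(2)])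
  have \<Phi>_lim: "(\<Phi> p \<longlongrightarrow> 0) (at_right 0)" if "positive_vec p" for p
    unfolding \<Phi>_def by (rule double_primitive_tendsto_0[OF int[OF that] cont[OF that]])
  have G_deriv: "(G p has_real_derivative profit_density r F (Q p) u) (at u)" if "positive_vec p" "0 < u" for p u
    unfolding G_def
    by (rule integral_from_0_has_derivative[OF integrable_on_from_0(1)[OF int[OF that(1)] cont[OF that(1)]] cont[OF that] that(2)])
  have G_lim: "(G p \<longlongrightarrow> 0) (at_right 0)" if "positive_vec p" for p
    unfolding G_def
    by (rule integral_from_0_tendsto_0[OF integrable_on_from_0(1)[OF int[OF that] cont[OF that]]])
  \<comment> \<open>Homogeneity is read off the original integral, where it is that of
    \<open>h_fun\<close>, rather than off the double primitive.\<close>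
  have \<Phi>_hom: "\<Phi> p p0 = p0 * \<Phi> (\<chi> i. p $ i / p0) 1" if p: "positive_vec p" and p0: "0 < p0" for p p0
  proof -
    have "max (p0 - h_fun r (p * x)) 0 * phi r f x
        = p0 * (max (1 - h_fun r ((\<chi> i. p $ i / p0) * x)) 0 * phi r f x)"
      if x: "x \<in> nonneg_orthant" for x
    proof -
      have "p * x \<in> nonneg_orthant"
        using p x by (auto simp: nonneg_orthant_def positive_vec_def less_imp_le)
      moreover have eq: "(\<chi> i. p $ i / p0) * x = (\<chi> i. (p * x) $ i / p0)" by (simp add: vec_eq_iff)
      ultimately have "h_fun r ((\<chi> i. p $ i / p0) * x) = h_fun r (p * x) / p0"
        unfolding eq by (intro h_fun_scale \<open>r < 0\<close> p0)
      then have "p0 * max (1 - h_fun r ((\<chi> i. p $ i / p0) * x)) 0 = max (p0 - h_fun r (p * x)) 0"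
        using p0 by (simp add: max_mult_distrib_left right_diff_distrib)
      then show ?thesis by (simp flip: mult.assoc)
    qed
    then have "(LBINT x:nonneg_orthant. max (p0 - h_fun r (p * x)) 0 * phi r f x)
      = (LBINT x:nonneg_orthant. p0 * (max (1 - h_fun r ((\<chi> i. p $ i / p0) * x)) 0 * phi r f x))"
      by (intro set_lebesgue_integral_cong) auto
    then show ?thesis
      using \<Phi>_eq[OF p p0] \<Phi>_eq[OF scale[OF p p0], of 1] by simp
  qed
  have "(\<forall>p p0. positive_vec p \<longrightarrow> p0 > 0 \<longrightarrow> P p p0 = \<Phi> p p0) \<longleftrightarrow>
         (\<forall>p. positive_vec p \<longrightarrow>
            (P p \<longlongrightarrow> 0) (at_right 0) \<and>
            (\<forall>p0>0. P p differentiable (at p0)) \<and>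
            (deriv (P p) \<longlongrightarrow> 0) (at_right 0)) \<and>
         (\<forall>p p0. positive_vec p \<longrightarrow> p0 > 0 \<longrightarrow>
            P p p0 = p0 * P (\<chi> i. p $ i / p0) 1) \<and>
         (\<forall>p. positive_vec p \<longrightarrow>
            (deriv (P (\<chi> i. (p $ i) powr (- 1 / r))) has_real_derivative laplace F p 1) (at 1))"
    (is "?L \<longleftrightarrow> ?R1 \<and> ?R2 \<and> ?R3")
  proof (intro iffI conjI)
    assume L: ?L
    have P_deriv: "(P p has_real_derivative G p u) (at u)" if p: "positive_vec p" and u: "0 < u" for p u
    proof -
      \<comment> \<open>The two functions agree for positive arguments only, but a neighbourhood of
        \<open>u\<close> suffices for the derivative.\<close>
      have "eventually (\<lambda>v. P p v = \<Phi> p v) (nhds u)"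
        using eventually_nhds_pos[OF u] by eventually_elim (use L p in auto)
      then show ?thesis using \<Phi>_deriv[OF p u] by (simp add: DERIV_cong_ev)
    qed
    then have deriv_eq: "deriv (P p) u = G p u" if "positive_vec p" "0 < u" for p u
      using that DERIV_imp_deriv by blast
    show ?R1
    proof (intro allI impI conjI)
      fix p :: "real ^ 'n" assume p: "positive_vec p"
      have "eventually (\<lambda>v. P p v = \<Phi> p v) (at_right 0)"
        using eventually_at_right_less[of "0 :: real"] by eventually_elim (use L p in auto)
      then show "(P p \<longlongrightarrow> 0) (at_right 0)" using \<Phi>_lim[OF p] by (simp add: tendsto_cong)
      have "eventually (\<lambda>v. deriv (P p) v = G p v) (at_right 0)"
        using eventually_at_right_less[of "0 :: real"] by eventually_elim (rule deriv_eq[OF p])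
      then show "(deriv (P p) \<longlongrightarrow> 0) (at_right 0)" using G_lim[OF p] by (simp add: tendsto_cong)
      show "P p differentiable (at p0)" if "0 < p0" for p0
        using P_deriv[OF p that] by (auto simp: real_differentiable_def)
    qed
    show ?R2
    proof (intro allI impI)
      fix p :: "real ^ 'n" and p0 :: real assume p: "positive_vec p" and p0: "0 < p0"
      show "P p p0 = p0 * P (\<chi> i. p $ i / p0) 1"
        using L[rule_format, OF p p0] L[rule_format, OF scale[OF p p0], of 1] \<Phi>_hom[OF p p0] by simp
    qed
    show ?R3
    proof (intro allI impI)
      fix p :: "real ^ 'n" assume p: "positive_vec p"
      define p' :: "real ^ 'n" where "p' = (\<chi> i. (p $ i) powr (- 1 / r))"
      have p': "positive_vec p'" unfolding p'_def using p by (rule positive_vec_powr)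
      have "Q p' = p" using p \<open>r < 0\<close>
        by (simp add: Q_def p'_def vec_eq_iff powr_powr positive_vec_def less_imp_le)
      then have "(G p' has_real_derivative laplace F p 1) (at 1)"
        using G_deriv[OF p', of 1] by (simp add: profit_density_def)
      moreover have "eventually (\<lambda>v. deriv (P p') v = G p' v) (nhds 1)"
        using eventually_nhds_pos[of 1, simplified] by eventually_elim (rule deriv_eq[OF p'])
      ultimately show "(deriv (P (\<chi> i. (p $ i) powr (- 1 / r))) has_real_derivative laplace F p 1) (at 1)"
        unfolding p'_def[symmetric] by (simp add: DERIV_cong_ev)
    qed
  next
    assume "?R1 \<and> ?R2 \<and> ?R3"
    then have R1: ?R1 and R2: ?R2 and R3: ?R3 by auto
    show ?L
    proof (intro allI impI)
      fix p :: "real ^ 'n" and p0 :: real assume p: "positive_vec p" and p0: "0 < p0"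
      have P_deriv: "(P p has_real_derivative deriv (P p) u) (at u)"
        if "positive_vec p" "0 < u" for p u
        using R1 that by (auto simp: real_differentiable_def dest: DERIV_imp_deriv)
      \<comment> \<open>Condition 3 is applied at the rescaled prices \<open>p / u\<close>, and
        condition 2 carries the result from \<open>1\<close> back to \<open>u\<close>.\<close>
      have P_deriv2: "(deriv (P p) has_real_derivative profit_density r F (Q p) u) (at u)" if u: "0 < u" for u
      proof -
        define p' :: "real ^ 'n" where "p' = (\<chi> i. p $ i / u)"
        have p': "positive_vec p'" unfolding p'_def by (rule scale[OF p u])
        have hom: "P p v = u * P p' (v / u)" if v: "0 < v" for v
        proof -
          have "(\<chi> i. p' $ i / (v / u)) = (\<chi> i. p $ i / v)"
            using u v by (simp add: p'_def vec_eq_iff)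
          then have "P p' (v / u) = v / u * P (\<chi> i. p $ i / v) 1"
            using R2[rule_format, OF p', of "v / u"] u v by (simp only: divide_pos_pos)
          then have "u * P p' (v / u) = v * P (\<chi> i. p $ i / v) 1"
            using u by (simp only:) simp
          also have "\<dots> = P p v" by (rule R2[rule_format, OF p v, symmetric])
          finally show ?thesis ..
        qed
        \<comment> \<open>The first derivative is homogeneous of degree 0: the factor
          \<open>u\<close> cancels the inner derivative \<open>1 / u\<close>.\<close>
        have deriv_eq: "deriv (P p) v = deriv (P p') (v / u)" if v: "0 < v" for v
        proof -
          have "((\<lambda>v. u * P p' (v / u)) has_real_derivative u * (deriv (P p') (v / u) * (1 / u))) (at v)"
            by (intro DERIV_cmult DERIV_chain2[where g = "\<lambda>v. v / u"] P_deriv p' DERIV_cdivide DERIV_ident)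
               (use u v in auto)
          moreover have "eventually (\<lambda>v. P p v = u * P p' (v / u)) (nhds v)"
            using eventually_nhds_pos[OF v] by eventually_elim (rule hom)
          ultimately have "(P p has_real_derivative deriv (P p') (v / u)) (at v)"
            using u by (simp add: DERIV_cong_ev)
          then show ?thesis by (rule DERIV_imp_deriv)
        qed
        have "(\<chi> i. (Q p' $ i) powr (- 1 / r)) = p'"
          using p' \<open>r < 0\<close> by (simp add: Q_def vec_eq_iff powr_powr positive_vec_def less_imp_le)
        then have "(deriv (P p') has_real_derivative laplace F (Q p') 1) (at 1)"
          using R3[rule_format, OF Q[OF p']] by (simp only:)
        then have "(deriv (P p') has_real_derivative laplace F (Q p') 1) (at (u / u))"
          using u by simp
        then have "((\<lambda>v. deriv (P p') (v / u)) has_real_derivative laplace F (Q p') 1 * (1 / u)) (at u)"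
          by (intro DERIV_chain2[where g = "\<lambda>v. v / u"] DERIV_cdivide DERIV_ident)
        moreover have "eventually (\<lambda>v. deriv (P p) v = deriv (P p') (v / u)) (nhds u)"
          using eventually_nhds_pos[OF u] by eventually_elim (rule deriv_eq)
        moreover have "laplace F (Q p') 1 * (1 / u) = profit_density r F (Q p) u"
        proof -
          \<comment> \<open>Scaling the direction by \<open>u powr r\<close> is the same as
            evaluating \<open>laplace\<close> for \<open>Q p\<close> at \<open>u powr r\<close>;
            with the factor \<open>1 / u\<close> from the chain rule this is the density at
            \<open>u\<close>.\<close>
          have "Q p' = u powr r *\<^sub>R Q p"
            using u p by (simp add: Q_def p'_def vec_eq_iff powr_divide positive_vec_def less_imp_le powr_minus field_simps)
          then show ?thesis by (simp add: profit_density_def laplace_def)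
        qed
        ultimately show ?thesis by (simp add: DERIV_cong_ev)
      qed
      \<comment> \<open>The second limit in condition 1 fixes the constant of the first integration;
        the first limit does so for the second one below.\<close>
      have deriv_eq: "deriv (P p) u - G p u = 0" if u: "0 < u" for u
      proof (rule eq_0_if_derivative_0[OF _ _ u])
        show "((\<lambda>u. deriv (P p) u - G p u) has_real_derivative 0) (at v)" if "0 < v" for v
          using DERIV_diff[OF P_deriv2[OF that] G_deriv[OF p that]] by simp
        show "((\<lambda>u. deriv (P p) u - G p u) \<longlongrightarrow> 0) (at_right 0)"
          using tendsto_diff[of "deriv (P p)" 0 _ "G p" 0] R1 p G_lim[OF p] by simp
      qed
      have "P p p0 - \<Phi> p p0 = 0"
      proof (rule eq_0_if_derivative_0[OF _ _ p0])
        show "((\<lambda>u. P p u - \<Phi> p u) has_real_derivative 0) (at v)" if "0 < v" for v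
          using DERIV_diff[OF P_deriv[OF p that] \<Phi>_deriv[OF p that]] deriv_eq[OF that] by simp
        show "((\<lambda>u. P p u - \<Phi> p u) \<longlongrightarrow> 0) (at_right 0)"
          using tendsto_diff[of "P p" 0 _ "\<Phi> p" 0] R1 p \<Phi>_lim[OF p] by simp
      qed
      then show "P p p0 = \<Phi> p p0" by simp
    qed
  qed
  then show ?thesis
    unfolding laplace_eq using \<Phi>_eq by simp
qed

end
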